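(* Assume the following conjecture: in the word-RAM model with $O(\log n)$-bit words, given an integer matrix $A\in\mathbb{Z}^{n\times n}$ and $n$ vectors $v^1,\dots,v^n\in\mathbb{Z}^n$ revealed one at a time (where $v^{i+1}$ is revealed only after $A\diamond v^i$ has been output), computing all the $(\min,+)$-products $A\diamond v^i$, where $(A\diamond v)_j=\min_{k=1}^n (A_{j,k}+v_k)$, requires $n^{3-o(1)}$ total time. Then there exists a data structure problem that has a partially retroactive data structure with operation time $O(\log n)$, but for which any fully retroactive data structure requires (amortized) $\Omega(n^{1-o(1)})$ time per operation (update or fully retroactive query) when $m=\Theta(n^2)$.
   Context: A data structure is viewed as a sequence of updates (the timeline) applied to an initial state; its size is $n$ and the timeline contains $m$ operations. A retroactive data structure allows inserting or deleting an update at any point of the timeline. It is partially retroactive if queries may only be asked about the present, i.e., the state resulting from applying the whole timeline; it is fully retroactive if queries may also be asked about the state resulting from any prefix of the timeline. The model of computation is the word-RAM with word size $\Theta(\log \max\{n,m\})$. *)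

theory Defs
  imports Complex_Main "HOL-Library.Landau_Symbols"
begin

section \<open>The word-RAM\<close>

text \<open>
  A machine with word length \<open>w\<close> has registers and random-access arrays ("banks"), both named by
  natural numbers; every cell holds a word, i.e. a natural number below \<open>2 ^ w\<close>, and every bank
  is addressed by words. A program is a finite term, so it uses a fixed finite number of registers
  and banks, independently of the input and of \<open>w\<close>. Structured control flow and a fixed number of
  banks instead of jumps and one memory change running times by constant factors only.
\<close>

record ram =
  reg :: "nat \<Rightarrow> nat"
  mem :: "nat \<Rightarrow> nat \<Rightarrow> nat"

datatype binop = Add | Sub | Mul | Div | Mod | And | Or | Xor | Shl | Shr | Less | Equal

fun word_op :: "nat \<Rightarrow> binop \<Rightarrow> nat \<Rightarrow> nat \<Rightarrow> nat" where
  "word_op w Add x y = (x + y) mod 2 ^ w"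
| "word_op w Sub x y = nat ((int x - int y) mod 2 ^ w)"
| "word_op w Mul x y = (x * y) mod 2 ^ w"
| "word_op w Div x y = x div y"
| "word_op w Mod x y = x mod y"
| "word_op w And x y = and x y"
| "word_op w Or x y = or x y"
| "word_op w Xor x y = xor x y"
| "word_op w Shl x y = (x * 2 ^ y) mod 2 ^ w"
| "word_op w Shr x y = x div 2 ^ y"
| "word_op w Less x y = (if x < y then 1 else 0)"
| "word_op w Equal x y = (if x = y then 1 else 0)"

text \<open>
  \<open>Load r b a\<close> reads bank \<open>b\<close> at the address held in register \<open>a\<close>, and \<open>Store b a r\<close> writes there;
  \<open>If r\<close> and \<open>While r\<close> test whether register \<open>r\<close> is nonzero.
\<close>

datatype program =
    Skip
  | Const nat nat
  | Op nat binop nat nat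
  | Load nat nat nat
  | Store nat nat nat
  | Seq program program
  | If nat program program
  | While nat program

definition set_reg :: "nat \<Rightarrow> nat \<Rightarrow> ram \<Rightarrow> ram" where
  "set_reg r x s = s\<lparr>reg := (reg s)(r := x)\<rparr>"

definition set_mem :: "nat \<Rightarrow> nat \<Rightarrow> nat \<Rightarrow> ram \<Rightarrow> ram" where
  "set_mem b a x s = s\<lparr>mem := (mem s)(b := (mem s b)(a := x))\<rparr>"

text \<open>
  \<open>exec w p s t s'\<close>: on word length \<open>w\<close>, program \<open>p\<close> started in \<open>s\<close> halts in \<open>s'\<close> after \<open>t\<close> unit-cost
  steps. Divergence is the absence of such \<open>t\<close> and \<open>s'\<close>.
\<close>

inductive exec :: "nat \<Rightarrow> program \<Rightarrow> ram \<Rightarrow> nat \<Rightarrow> ram \<Rightarrow> bool" for w where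
  Skip: "exec w Skip s 1 s"
| Const: "exec w (Const r k) s 1 (set_reg r (k mod 2 ^ w) s)"
| Op: "exec w (Op r f x y) s 1 (set_reg r (word_op w f (reg s x) (reg s y)) s)"
| Load: "exec w (Load r b a) s 1 (set_reg r (mem s b (reg s a)) s)"
| Store: "exec w (Store b a r) s 1 (set_mem b (reg s a) (reg s r) s)"
| Seq: "exec w p s t s' \<Longrightarrow> exec w q s' u s'' \<Longrightarrow> exec w (Seq p q) s (t + u) s''"
| IfTrue: "reg s r \<noteq> 0 \<Longrightarrow> exec w p s t s' \<Longrightarrow> exec w (If r p q) s (t + 1) s'"
| IfFalse: "reg s r = 0 \<Longrightarrow> exec w q s t s' \<Longrightarrow> exec w (If r p q) s (t + 1) s'"
| WhileTrue: "reg s r \<noteq> 0 \<Longrightarrow> exec w p s t s' \<Longrightarrow> exec w (While r p) s' u s'' \<Longrightarrow>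
    exec w (While r p) s (t + u + 1) s''"
| WhileFalse: "reg s r = 0 \<Longrightarrow> exec w (While r p) s 1 s"

inductive_cases exec_cases:
  "exec w Skip s t s'"
  "exec w (Const r k) s t s'"
  "exec w (Op r f x y) s t s'"
  "exec w (Load r b a) s t s'"
  "exec w (Store b a r) s t s'"
  "exec w (Seq p q) s t s'"
  "exec w (If r p q) s t s'"
  "exec w (While r p) s t s'"

text \<open>
  Hence "there is a run such that ..." below speaks about the unique run, and the
  part of an interaction that has already happened cannot depend on later inputs.
\<close>

lemma exec_deterministic:
  "exec w p s t s' \<Longrightarrow> exec w p s u s'' \<Longrightarrow> t = u \<and> s' = s''"
proof (induction arbitrary: u s'' rule: exec.induct)
  case (Seq p s t s' q t' s1)
  from Seq.prems show ?case
  proof (rule exec_cases(6))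
    fix u1 r u2 assume u: "u = u1 + u2" and p: "exec w p s u1 r" and q: "exec w q r u2 s''"
    from Seq.IH(1)[OF p] have eq: "t = u1" "s' = r" by blast+
    from Seq.IH(2)[unfolded eq(2), OF q] show ?case unfolding u eq(1) by blast
  qed
next
  case (IfTrue s r p t s' q)
  from IfTrue.prems show ?case
  proof (rule exec_cases(7))
    fix u1 assume u: "u = Suc u1" and p: "exec w p s u1 s''"
    from IfTrue.IH[OF p] show ?case unfolding u by linarith
  qed (use IfTrue.hyps in linarith)
next
  case (IfFalse s r q t s' p)
  from IfFalse.prems show ?case
  proof (rule exec_cases(7))
    fix u1 assume u: "u = Suc u1" and q: "exec w q s u1 s''"
    from IfFalse.IH[OF q] show ?case unfolding u by linarith
  qed (use IfFalse.hyps in linarith)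
next
  case (WhileTrue s r p t s' t' s1)
  from WhileTrue.prems show ?case
  proof (rule exec_cases(8))
    fix u1 r' u2
    assume u: "u = Suc (u1 + u2)" and p: "exec w p s u1 r'" and q: "exec w (While r p) r' u2 s''"
    from WhileTrue.IH(1)[OF p] have eq: "t = u1" "s' = r'" by blast+
    from WhileTrue.IH(2)[unfolded eq(2), OF q] show ?case unfolding u eq(1) by linarith
  qed (use WhileTrue.hyps in linarith)
next
  case (WhileFalse s r p)
  from WhileFalse.prems show ?case
    by (rule exec_cases(8)) (use WhileFalse.hyps in simp_all)
qed (erule exec_cases(1-5), simp)+

definition blank :: ram where
  "blank = \<lparr>reg = (\<lambda>_. 0), mem = (\<lambda>_ _. 0)\<rparr>"

text \<open>Arguments of a call are placed in the registers \<open>0, 1, \<dots>\<close>; everything else persists.\<close>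

definition pass :: "nat list \<Rightarrow> ram \<Rightarrow> ram" where
  "pass xs s = s\<lparr>reg := (\<lambda>i. if i < length xs then xs ! i else reg s i)\<rparr>"

definition words :: "nat \<Rightarrow> nat \<Rightarrow> nat list set" where
  "words w k = {xs. length xs = k \<and> set xs \<subseteq> {..<2 ^ w}}"

text \<open>
  \<open>word_length c N W\<close>: the word length \<open>W n\<close> used on instances of parameter \<open>n\<close> is
  \<open>\<Theta>(log (N n))\<close>, where \<open>c\<close> is the implicit constant of the lower bound. For \<open>c \<ge> 1\<close> the numbers
  \<open>0, \<dots>, N n\<close> are words.
\<close>

definition word_length :: "real \<Rightarrow> (nat \<Rightarrow> nat) \<Rightarrow> (nat \<Rightarrow> nat) \<Rightarrow> bool" where
  "word_length c N W \<longleftrightarrow>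
     (\<forall>n. c * log 2 (real (N n) + 1) \<le> real (W n)) \<and>
     (\<lambda>n. real (W n)) \<in> O(\<lambda>n. log 2 (real (N n) + 1))"

text \<open>
  \<open>T(n) = \<Omega>(n powr (a - o(1)))\<close>. A constant factor can be absorbed in \<open>n powr o(1)\<close>, so this is
  also the meaning of "\<open>T(n)\<close> is at least \<open>n powr (a - o(1))\<close>".
\<close>

definition almost_power_lower_bound :: "real \<Rightarrow> (nat \<Rightarrow> real) \<Rightarrow> bool" where
  "almost_power_lower_bound a T \<longleftrightarrow>
     (\<exists>f \<in> o(\<lambda>_. 1). T \<in> \<Omega>(\<lambda>n. real n powr (a - f n)))"

section \<open>Online (min,+)-products\<close>

definition minplus_mult :: "nat \<Rightarrow> (nat \<Rightarrow> nat \<Rightarrow> int) \<Rightarrow> (nat \<Rightarrow> int) \<Rightarrow> nat \<Rightarrow> int" where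
  "minplus_mult n A v j = Min ((\<lambda>k. A j k + v k) ` {..<n})"

text \<open>Two's complement\<close>

definition encode :: "nat \<Rightarrow> int \<Rightarrow> nat" where
  "encode w x = nat (x mod 2 ^ w)"

text \<open>The entries leave one bit to spare, so that a sum of two of them is still representable.\<close>

definition entry :: "nat \<Rightarrow> int \<Rightarrow> bool" where
  "entry w x \<longleftrightarrow> - (2 ^ w) \<le> 4 * x \<and> 4 * x < 2 ^ w"

text \<open>
  The matrix is supplied in bank 0 in row-major order, each vector in bank 1 (just before the call
  that has to process it), and the product is expected in bank 2. Rows and columns are numbered
  from 0.
\<close>

definition load_matrix :: "nat \<Rightarrow> nat \<Rightarrow> (nat \<Rightarrow> nat \<Rightarrow> int) \<Rightarrow> ram" where
  "load_matrix w n A =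
     blank\<lparr>mem := (\<lambda>_ _. 0)(0 := (\<lambda>a. if a < n * n then encode w (A (a div n) (a mod n)) else 0))\<rparr>"

definition load_vector :: "nat \<Rightarrow> nat \<Rightarrow> (nat \<Rightarrow> int) \<Rightarrow> ram \<Rightarrow> ram" where
  "load_vector w n v s =
     s\<lparr>mem := (mem s)(1 := (\<lambda>k. if k < n then encode w (v k) else mem s 1 k))\<rparr>"

primrec online_products ::
  "nat \<Rightarrow> nat \<Rightarrow> (nat \<Rightarrow> nat \<Rightarrow> int) \<Rightarrow> program \<Rightarrow> ram \<Rightarrow> (nat \<Rightarrow> int) list \<Rightarrow> nat \<Rightarrow> bool" where
  "online_products w n A step s [] t \<longleftrightarrow> t = 0"
| "online_products w n A step s (v # vs) t \<longleftrightarrow>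
     (\<exists>t1 s1 t2. exec w step (load_vector w n v s) t1 s1 \<and>
        (\<forall>j<n. mem s1 2 j = encode w (minplus_mult n A v j)) \<and>
        online_products w n A step s1 vs t2 \<and> t = t1 + t2)"

text \<open>
  On instances of dimension \<open>n\<close>, preprocessing the matrix with \<open>prep\<close> and then processing \<open>n\<close> vectors
  one after the other with \<open>step\<close> is correct and takes total time at most \<open>T\<close>.
\<close>

definition solves_online_minplus :: "nat \<Rightarrow> nat \<Rightarrow> program \<Rightarrow> program \<Rightarrow> real \<Rightarrow> bool" where
  "solves_online_minplus w n prep step T \<longleftrightarrow>
     (\<forall>A vs. (\<forall>j<n. \<forall>k<n. entry w (A j k)) \<longrightarrow> length vs = n \<longrightarrow>
        (\<forall>v\<in>set vs. \<forall>k<n. entry w (v k)) \<longrightarrow>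
        (\<exists>t0 s0 t. exec w prep (pass [n] (load_matrix w n A)) t0 s0 \<and>
           online_products w n A step s0 vs t \<and> real (t0 + t) \<le> T))"

definition online_minplus_conjecture :: "real \<Rightarrow> bool" where
  "online_minplus_conjecture c \<longleftrightarrow>
     (\<forall>W prep step T. word_length c (\<lambda>n. n\<^sup>2) W \<longrightarrow>
        (\<forall>n\<ge>1. solves_online_minplus (W n) n prep step (T n)) \<longrightarrow>
        almost_power_lower_bound 3 T)"

section \<open>Data structure problems and retroactivity\<close>

text \<open>
  The state of a structure of size \<open>n\<close> is a sequence of \<open>n\<close> words. Updates and queries are given by
  a fixed number of words, and a query is answered by one word. As usual for problems on words, the
  operations may refer to the word length, which is the first argument of the three functions.
\<close>

record ds_problem =
  update_arity :: nat
  query_arity :: nat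
  start :: "nat \<Rightarrow> nat \<Rightarrow> nat list"
  apply_update :: "nat \<Rightarrow> nat list \<Rightarrow> nat list \<Rightarrow> nat list"
  answer :: "nat \<Rightarrow> nat list \<Rightarrow> nat list \<Rightarrow> nat"

definition data_structure_problem :: "ds_problem \<Rightarrow> bool" where
  "data_structure_problem P \<longleftrightarrow>
     (\<forall>w n. n < 2 ^ w \<longrightarrow>
        start P w n \<in> words w n \<and>
        (\<forall>u\<in>words w (update_arity P). \<forall>s\<in>words w n. apply_update P w u s \<in> words w n) \<and>
        (\<forall>q\<in>words w (query_arity P). \<forall>s\<in>words w n. answer P w q s < 2 ^ w))"

text \<open>
  The updates on a timeline carry distinct nonzero names, which are words. A point of the timeline
  is given by the name of the update that precedes it, and the beginning by 0; thus every gap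
  between two consecutive updates can be addressed.
\<close>

type_synonym timeline = "(nat \<times> nat list) list"

definition points :: "timeline \<Rightarrow> nat set" where
  "points L = insert 0 (fst ` set L)"

definition present :: "timeline \<Rightarrow> nat" where
  "present L = (if L = [] then 0 else fst (last L))"

fun prefix_until :: "nat \<Rightarrow> timeline \<Rightarrow> timeline" where
  "prefix_until p [] = []"
| "prefix_until p (e # L) =
     (if p = 0 then [] else if fst e = p then [e] else e # prefix_until p L)"

definition state_at :: "ds_problem \<Rightarrow> nat \<Rightarrow> nat \<Rightarrow> timeline \<Rightarrow> nat \<Rightarrow> nat list" where
  "state_at P w n L p = fold (apply_update P w) (map snd (prefix_until p L)) (start P w n)"

text \<open>
  \<open>Insert p a u\<close> inserts the update \<open>u\<close>, named \<open>a\<close>, at the point \<open>p\<close>; \<open>Delete a\<close> deletes the update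
  named \<open>a\<close>; \<open>Query p q\<close> asks \<open>q\<close> about the state reached at the point \<open>p\<close>.
\<close>

datatype retro_op = Insert nat nat "nat list" | Delete nat | Query nat "nat list"

fun edit :: "retro_op \<Rightarrow> timeline \<Rightarrow> timeline" where
  "edit (Insert p a u) L =
     prefix_until p L @ (a, u) # drop (length (prefix_until p L)) L"
| "edit (Delete a) L = filter (\<lambda>e. fst e \<noteq> a) L"
| "edit (Query p q) L = L"

datatype retroactivity = Partial | Full

fun legal :: "retroactivity \<Rightarrow> ds_problem \<Rightarrow> nat \<Rightarrow> nat \<Rightarrow> timeline \<Rightarrow> retro_op \<Rightarrow> bool" where
  "legal k P m w L (Insert p a u) \<longleftrightarrow>
     length L < m \<and> p \<in> points L \<and> a \<notin> points L \<and> a < 2 ^ w \<and> u \<in> words w (update_arity P)"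
| "legal k P m w L (Delete a) \<longleftrightarrow> a \<in> fst ` set L"
| "legal k P m w L (Query p q) \<longleftrightarrow>
     (case k of Partial \<Rightarrow> p = present L | Full \<Rightarrow> p \<in> points L) \<and> q \<in> words w (query_arity P)"

primrec legal_ops ::
  "retroactivity \<Rightarrow> ds_problem \<Rightarrow> nat \<Rightarrow> nat \<Rightarrow> timeline \<Rightarrow> retro_op list \<Rightarrow> bool" where
  "legal_ops k P m w L [] \<longleftrightarrow> True"
| "legal_ops k P m w L (x # xs) \<longleftrightarrow> legal k P m w L x \<and> legal_ops k P m w (edit x L) xs"

record data_structure =
  init_code :: program
  insert_code :: program
  delete_code :: program
  query_code :: program

fun call :: "data_structure \<Rightarrow> retro_op \<Rightarrow> program \<times> nat list" where
  "call D (Insert p a u) = (insert_code D, p # a # u)"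
| "call D (Delete a) = (delete_code D, [a])"
| "call D (Query p q) = (query_code D, p # q)"

fun correct :: "ds_problem \<Rightarrow> nat \<Rightarrow> nat \<Rightarrow> timeline \<Rightarrow> retro_op \<Rightarrow> nat \<Rightarrow> bool" where
  "correct P w n L (Query p q) y \<longleftrightarrow> y = answer P w q (state_at P w n L p)"
| "correct P w n L _ y \<longleftrightarrow> True"

text \<open>
  \<open>operates P n w D L s xs ts\<close>: started in \<open>s\<close> with timeline \<open>L\<close>, the structure performs the
  operations \<open>xs\<close>, answering (in register 0) all queries correctly; \<open>ts\<close> lists the time each
  operation takes.
\<close>

primrec operates ::
  "ds_problem \<Rightarrow> nat \<Rightarrow> nat \<Rightarrow> data_structure \<Rightarrow> timeline \<Rightarrow> ram \<Rightarrow> retro_op list \<Rightarrow> nat list \<Rightarrow> bool"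
where
  "operates P n w D L s [] ts \<longleftrightarrow> ts = []"
| "operates P n w D L s (x # xs) ts \<longleftrightarrow>
     (\<exists>t s' ts'. exec w (fst (call D x)) (pass (snd (call D x)) s) t s' \<and>
        correct P w n L x (reg s' 0) \<and>
        operates P n w D (edit x L) s' xs ts' \<and> ts = t # ts')"

text \<open>
  \<open>retroactive_ds k P n m w D B\<close>: for size \<open>n\<close>, word length \<open>w\<close>, and all sequences of operations during
  which the timeline contains at most \<open>m\<close> updates, \<open>D\<close> is a \<open>k\<close>-retroactive data structure for \<open>P\<close>, and
  \<open>B\<close> holds for the time of the initialisation and the times of the operations.
\<close>

definition retroactive_ds ::
  "retroactivity \<Rightarrow> ds_problem \<Rightarrow> nat \<Rightarrow> nat \<Rightarrow> nat \<Rightarrow> data_structure \<Rightarrow>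
   (nat \<Rightarrow> nat list \<Rightarrow> bool) \<Rightarrow> bool" where
  "retroactive_ds k P n m w D B \<longleftrightarrow>
     (\<exists>t0 s0. exec w (init_code D) (pass [n] blank) t0 s0 \<and>
        (\<forall>xs. legal_ops k P m w [] xs \<longrightarrow> (\<exists>ts. operates P n w D [] s0 xs ts \<and> B t0 ts)))"

text \<open>Setting up the initial state of size \<open>n\<close> is charged like \<open>n + 1\<close> operations.\<close>

definition worst_case :: "nat \<Rightarrow> real \<Rightarrow> nat \<Rightarrow> nat list \<Rightarrow> bool" where
  "worst_case n T t0 ts \<longleftrightarrow> real t0 \<le> (real n + 1) * T \<and> (\<forall>t\<in>set ts. real t \<le> T)"

definition amortized :: "nat \<Rightarrow> real \<Rightarrow> nat \<Rightarrow> nat list \<Rightarrow> bool" where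
  "amortized n T t0 ts \<longleftrightarrow> real (t0 + sum_list ts) \<le> (real n + 1 + real (length ts)) * T"

end

theory Submission
  imports Defs
begin

text \<open>
  The problem is to maintain an array of words under additions to single cells and queries for the
  maximum. As additions commute and can be undone, an update at any point of the timeline changes
  the present like an update made now, and a tree of maxima over the array handles it in
  logarithmic time. If however the timeline adds the differences of consecutive rows of a matrix
  \<open>A\<close>, one row after the other, then after row \<open>j\<close> the cells have changed by row \<open>j\<close> (negated), so adding a
  vector \<open>v\<close> (negated and shifted) at the beginning makes the maximum after row \<open>j\<close> encode
  \<open>min\<^sub>k (A j k + v k)\<close>. Thus \<open>O(d ^ 2)\<close> operations on structures of size \<open>n = \<Theta>(d)\<close> compute \<open>d\<close> products online.
  To get a bound for every \<open>n\<close>, the reduction is made for \<open>n = K * d + r\<close> with a constant \<open>K\<close>, which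
  leaves room for \<open>d ^ 2 + d\<close> updates, and each of the finitely many residues \<open>r < K\<close>.
\<close>

subsection \<open>A calculus of runs\<close>

text \<open>The fully retroactive structure is a black box, and its bound \<open>T\<close> need not
  be monotone, so a bound on \<open>T n\<close> has to come from an instance of exactly this size;
  this is why \<open>K\<close> and \<open>r\<close> become constants of the code. The timeline never
  exceeds \<open>d * d + d\<close> updates because each vector is deleted again before the next one
  is inserted; storing differences of rows is what lets a single timeline answer for all rows. The
  matrix costs \<open>d * d\<close> operations and each vector \<open>3 * d\<close>, together
  \<open>4 * d * d\<close>, so a total time of d powr (3 - o(1)) leaves d powr (1 - o(1)) for each
  of them. As that cost is amortized, no single call has a known bound: the invariants carry the
  time that the structure will still spend as a budget.\<close>

definition runs :: "nat \<Rightarrow> program \<Rightarrow> ram \<Rightarrow> (nat \<Rightarrow> ram \<Rightarrow> bool) \<Rightarrow> bool" where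
  "runs w p s Q \<longleftrightarrow> (\<exists>t s'. exec w p s t s' \<and> Q t s')"

abbreviation seq :: "program \<Rightarrow> program \<Rightarrow> program" (infixr ";;" 60) where
  "p ;; q \<equiv> Seq p q"

lemma runs_mono: "runs w p s Q \<Longrightarrow> (\<And>t s'. Q t s' \<Longrightarrow> Q' t s') \<Longrightarrow> runs w p s Q'"
  unfolding runs_def by blast

text \<open>These equations and those for \<open>Seq\<close> and \<open>If\<close> form a
  weakest-precondition calculus: the simplifier executes straight-line code and adds up its
  steps.\<close>

lemma runs_Skip [simp]: "runs w Skip s Q \<longleftrightarrow> Q 1 s"
  and runs_Const [simp]: "runs w (Const r k) s Q \<longleftrightarrow> Q 1 (set_reg r (k mod 2 ^ w) s)"
  and runs_Op [simp]: "runs w (Op r f x y) s Q \<longleftrightarrow>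
    Q 1 (set_reg r (word_op w f (reg s x) (reg s y)) s)"
  and runs_Load [simp]: "runs w (Load r b a) s Q \<longleftrightarrow> Q 1 (set_reg r (mem s b (reg s a)) s)"
  and runs_Store [simp]: "runs w (Store b a r) s Q \<longleftrightarrow> Q 1 (set_mem b (reg s a) (reg s r) s)"
  unfolding runs_def
  by (auto intro: exec.intros(1-5)[unfolded One_nat_def] elim!: exec_cases(1-5)
      simp del: word_op.simps)

lemma runs_Seq [simp]:
  "runs w (p ;; q) s Q \<longleftrightarrow> runs w p s (\<lambda>t s'. runs w q s' (\<lambda>u. Q (t + u)))"
  unfolding runs_def by (blast intro: exec.Seq elim: exec_cases(6))

lemma runs_If [simp]:
  "runs w (If r p q) s Q \<longleftrightarrow>
     (if reg s r = 0 then runs w q s (\<lambda>t. Q (t + 1)) else runs w p s (\<lambda>t. Q (t + 1)))"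
proof (cases "reg s r = 0")
  case True
  then show ?thesis
    unfolding runs_def by (auto elim!: exec_cases(7) intro: exec.IfFalse[simplified])
next
  case False
  then show ?thesis
    unfolding runs_def by (auto elim!: exec_cases(7) intro: exec.IfTrue[simplified])
qed

text \<open>Not a simp rule, as it would unfold forever; \<open>subst\<close> applies it
  once.\<close>

lemma runs_While:
  "runs w (While r p) s Q \<longleftrightarrow>
     (if reg s r = 0 then Q 1 s
      else runs w p s (\<lambda>t s'. runs w (While r p) s' (\<lambda>u. Q (t + u + 1))))"
proof (cases "reg s r = 0")
  case True
  have "t = 1 \<and> s' = s" if "exec w (While r p) s t s'" for t s'
    using that True by (rule_tac exec_cases(8)) auto
  then show ?thesis
    using True exec.WhileFalse[of s r w p] unfolding runs_def by metis
next
  case False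
  have "\<exists>t s1 u. exec w p s t s1 \<and> exec w (While r p) s1 u s' \<and> v = t + u + 1"
    if "exec w (While r p) s v s'" for v s'
    using that by (rule exec_cases(8)) (use False in auto)
  moreover have "exec w (While r p) s (t + u + 1) s'"
    if "exec w p s t s1" "exec w (While r p) s1 u s'" for t s1 u s'
    using False that by (rule exec.WhileTrue)
  ultimately have "runs w (While r p) s Q \<longleftrightarrow>
      runs w p s (\<lambda>t s'. runs w (While r p) s' (\<lambda>u. Q (t + u + 1)))"
    unfolding runs_def by metis
  then show ?thesis
    using False by simp
qed

text \<open>The measure \<open>\<phi>\<close> is a time budget: what the body takes beyond \<open>c\<close> has to be paid from it.\<close>

lemma runs_countdown:
  assumes body: "\<And>i s \<phi>. Inv (Suc i) s \<phi> \<Longrightarrow>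
      runs w p s (\<lambda>t s'. \<exists>\<phi>'. Inv i s' \<phi>' \<and> t + \<phi>' \<le> c + \<phi>)"
    and counter: "\<And>i s \<phi>. Inv i s \<phi> \<Longrightarrow> reg s r = i"
  shows "Inv k s \<phi> \<Longrightarrow>
    runs w (While r p) s (\<lambda>t s'. \<exists>\<phi>'. Inv 0 s' \<phi>' \<and> t + \<phi>' \<le> (c + 1) * k + 1 + \<phi>)"
proof (induction k arbitrary: s \<phi>)
  case 0
  then show ?case
    using counter[OF 0] by (subst runs_While) auto
next
  case (Suc k)
  have "runs w p s (\<lambda>t s'. runs w (While r p) s' (\<lambda>u s''. \<exists>\<phi>'. Inv 0 s'' \<phi>' \<and>
          t + u + 1 + \<phi>' \<le> (c + 1) * Suc k + 1 + \<phi>))"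
  proof (rule runs_mono[OF body[OF Suc.prems]])
    fix t s' assume "\<exists>\<phi>'. Inv k s' \<phi>' \<and> t + \<phi>' \<le> c + \<phi>"
    then obtain \<phi>' where \<phi>': "Inv k s' \<phi>'" "t + \<phi>' \<le> c + \<phi>" by blast
    show "runs w (While r p) s' (\<lambda>u s''. \<exists>\<phi>'. Inv 0 s'' \<phi>' \<and>
          t + u + 1 + \<phi>' \<le> (c + 1) * Suc k + 1 + \<phi>)"
      by (rule runs_mono[OF Suc.IH[OF \<phi>'(1)]]) (use \<phi>'(2) in auto)
  qed
  then show ?case
    using counter[OF Suc.prems] by (subst runs_While) auto
qed

lemma reg_set_reg [simp]: "reg (set_reg r x s) = (reg s)(r := x)"
  and mem_set_reg [simp]: "mem (set_reg r x s) = mem s"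
  and reg_set_mem [simp]: "reg (set_mem b a x s) = reg s"
  and mem_set_mem [simp]: "mem (set_mem b a x s) = (mem s)(b := (mem s b)(a := x))"
  and reg_pass [simp]: "reg (pass xs s) = (\<lambda>i. if i < length xs then xs ! i else reg s i)"
  and mem_pass [simp]: "mem (pass xs s) = mem s"
  by (simp_all add: set_reg_def set_mem_def pass_def)

subsection \<open>The problem\<close>

text \<open>An index beyond the array leaves the list as it is, so every pair of words is an
  admissible update; the test in \<open>add_code\<close> mirrors this.\<close>

definition bump :: "nat \<Rightarrow> nat list \<Rightarrow> nat list \<Rightarrow> nat list" where
  "bump w u s = s[u ! 0 := (s ! (u ! 0) + u ! 1) mod 2 ^ w]"

text \<open>Inserting 0 gives the empty array a maximum and changes no other.\<close>

definition max_problem :: ds_problem where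
  "max_problem = \<lparr>update_arity = 2, query_arity = 0, start = (\<lambda>w n. replicate n 0),
     apply_update = bump, answer = (\<lambda>w q s. Max (insert 0 (set s)))\<rparr>"

lemma max_problem_simps [simp]:
  "update_arity max_problem = 2" "query_arity max_problem = 0"
  "start max_problem w n = replicate n 0" "apply_update max_problem = bump"
  "answer max_problem w q s = Max (insert 0 (set s))"
  by (simp_all add: max_problem_def)

lemma data_structure_problem_max_problem: "data_structure_problem max_problem"
  unfolding data_structure_problem_def
proof (intro allI impI conjI ballI)
  fix w n :: nat and u s :: "nat list"
  assume "s \<in> words w n"
  then show "apply_update max_problem w u s \<in> words w n"
    using set_update_subset_insert[of s "u ! 0"] by (fastforce simp: words_def bump_def)
qed (auto simp: words_def)

text \<open>Kept as a plain sum, without reduction modulo \<open>2 ^ w\<close>, so that it is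
  additive under concatenation and indifferent to order: an edit in the past changes it like an edit
  at the end.\<close>

definition added :: "nat \<Rightarrow> nat list list \<Rightarrow> nat" where
  "added k us = (\<Sum>u\<leftarrow>us. if u ! 0 = k then u ! 1 else 0)"

lemma added_simps [simp]:
  "added k [] = 0"
  "added k (u # us) = (if u ! 0 = k then u ! 1 else 0) + added k us"
  "added k (us @ us') = added k us + added k us'"
  by (simp_all add: added_def)

lemma length_fold_bump [simp]: "length (fold (bump w) us s) = length s"
  by (induction us arbitrary: s) (simp_all add: bump_def)

lemma nth_fold_bump:
  "k < length s \<Longrightarrow> s ! k < 2 ^ w \<Longrightarrow> fold (bump w) us s ! k = (s ! k + added k us) mod 2 ^ w"
proof (induction us arbitrary: s)
  case (Cons u us)
  then show ?case
    by (auto simp: bump_def nth_list_update mod_simps ac_simps)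
qed simp

lemma Max_state_at:
  "Max (insert 0 (set (state_at max_problem w n L p))) =
     Max (insert 0 ((\<lambda>k. added k (map snd (prefix_until p L)) mod 2 ^ w) ` {..<n}))"
proof -
  have "set (state_at max_problem w n L p) =
      (\<lambda>k. added k (map snd (prefix_until p L)) mod 2 ^ w) ` {..<n}"
    by (auto simp: state_at_def set_conv_nth nth_fold_bump image_iff intro!: exI)
  then show ?thesis by simp
qed

section \<open>Prefixes of timelines\<close>

lemma prefix_until_append_drop: "prefix_until p L @ drop (length (prefix_until p L)) L = L"
  by (induction L) auto

lemma prefix_until_notin:
  "p \<notin> fst ` set L \<Longrightarrow> p \<noteq> 0 \<Longrightarrow> prefix_until p (L @ L') = L @ prefix_until p L'"
  by (induction L) auto

text \<open>Names are distinct, so the name of the last update does not occur earlier and the search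
  runs through the whole timeline.\<close>

lemma prefix_until_present:
  assumes "distinct (map fst L)" "0 \<notin> fst ` set L"
  shows "prefix_until (present L) L = L"
proof (cases L rule: rev_cases)
  case (snoc L' e)
  then show ?thesis
    using assms prefix_until_notin[of "fst e" L' "[e]"] by (auto simp: present_def)
qed simp

text \<open>The reason why a deletion can be executed as the addition of the two's
  complement.\<close>

lemma nat_mod_add_sub:
  fixes S x :: nat
  shows "(S + x + nat ((- int x) mod 2 ^ w)) mod 2 ^ w = S mod 2 ^ w"
proof -
  have "int ((S + x + nat ((- int x) mod 2 ^ w)) mod 2 ^ w) = int (S mod 2 ^ w)"
    by (simp add: zmod_int mod_simps)
  then show ?thesis by linarith
qed

subsection \<open>A partially retroactive data structure\<close>

text \<open>
  The nodes \<open>1, \<dots>, n\<close> form a heap-shaped binary tree; node \<open>k + 1\<close> carries cell \<open>k\<close> of the array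
  (bank 0) and the maxima of the subtrees of its two children \<open>2 * i\<close> (bank 1) and \<open>2 * i + 1\<close>
  (bank 2). Keeping the maximum of a subtree at its parent avoids addresses above \<open>n\<close>, which
  might not be words. Node 1 counts as the right child of 0. Banks 3 and 4 hold the two arguments of
  the update with a given name. Register 4 holds \<open>n\<close>.
\<close>

definition max_into :: "nat \<Rightarrow> nat \<Rightarrow> program" where
  "max_into x y = Op 9 Less x y ;; If 9 (Op x Or y y) Skip"

text \<open>Register 2 is the current node. Register 6 holds 1, both the mask for its parity, which
  selects the bank at the parent, and the shift that leads to the parent. Node 0 ends the
  climb.\<close>

definition climb_step :: program where
  "climb_step =
     Load 7 0 2 ;; Load 8 1 2 ;; max_into 7 8 ;; Load 8 2 2 ;; max_into 7 8 ;;
     Op 8 And 2 6 ;; Op 2 Shr 2 6 ;; If 8 (Store 2 2 7) (Store 1 2 7)"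

abbreviation climb :: program where
  "climb \<equiv> While 2 climb_step"

definition add_at :: program where
  "add_at = Const 6 1 ;; Op 2 Add 2 6 ;; Load 7 0 2 ;; Op 7 Add 7 3 ;; Store 0 2 7 ;; climb"

definition add_code :: program where
  "add_code = Op 5 Less 2 4 ;; If 5 add_at Skip"

text \<open>Memory full of zeros already is the tree of the initial array, so the initialisation
  only copies \<open>n\<close>. Arguments occupy at most registers 0 to 3, hence register 4 survives
  all calls.\<close>

definition max_tree :: data_structure where
  "max_tree = \<lparr>
     init_code = Op 4 Or 0 0,
     insert_code = Store 3 1 2 ;; Store 4 1 3 ;; add_code,
     delete_code = Load 2 3 0 ;; Load 3 4 0 ;; Const 5 0 ;; Op 3 Sub 5 3 ;; add_code,
     query_code = Const 5 0 ;; Load 0 2 5\<rparr>"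

definition node_max :: "(nat \<Rightarrow> nat \<Rightarrow> nat) \<Rightarrow> nat \<Rightarrow> nat" where
  "node_max M i = max (M 0 i) (max (M 1 i) (M 2 i))"

definition kept_max :: "(nat \<Rightarrow> nat \<Rightarrow> nat) \<Rightarrow> nat \<Rightarrow> nat" where
  "kept_max M i = M (if odd i then 2 else 1) (i div 2)"

text \<open>The zeros beyond \<open>n\<close> stand for missing children; thanks to them the
  equation can be required at every node, without a case distinction at the leaves.\<close>

definition is_tree :: "nat \<Rightarrow> (nat \<Rightarrow> nat \<Rightarrow> nat) \<Rightarrow> bool" where
  "is_tree n M \<longleftrightarrow> (\<forall>i\<ge>1. kept_max M i = node_max M i) \<and> (\<forall>b<3. \<forall>i>n. M b i = 0)"

lemma is_tree_cong: "(\<And>b. b < 3 \<Longrightarrow> M b = M' b) \<Longrightarrow> is_tree n M \<longleftrightarrow> is_tree n M'"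
  by (simp add: is_tree_def kept_max_def node_max_def)

text \<open>Induction towards the root shows that no node exceeds node 1; induction towards the
  leaves, which stops beyond \<open>n\<close> where everything is 0, shows that no node exceeds the
  maximum of the cells.\<close>

lemma tree_root:
  assumes "is_tree n M"
  shows "M 2 0 = Max (insert 0 ((\<lambda>k. M 0 (Suc k)) ` {..<n}))"
proof -
  have kept: "kept_max M i = node_max M i" if "i \<ge> 1" for i
    using assms that by (simp add: is_tree_def)
  have root: "M 2 0 = node_max M 1"
    using kept[of 1] by (simp add: kept_max_def)
  have ge: "node_max M i \<le> node_max M 1" if "i \<ge> 1" for i
    using that
  proof (induction i rule: less_induct)
    case (less i)
    show ?case
    proof (cases "i = 1")
      case False
      with less.prems have i: "i div 2 < i" "1 \<le> i div 2" by auto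
      have "node_max M i \<le> node_max M (i div 2)"
        using kept[OF less.prems] by (auto simp: kept_max_def node_max_def[of M "i div 2"] split: if_splits)
      also have "\<dots> \<le> node_max M 1" by (rule less.IH[OF i])
      finally show ?thesis .
    qed simp
  qed
  let ?A = "insert 0 ((\<lambda>k. M 0 (Suc k)) ` {..<n})"
  have le: "node_max M i \<le> Max ?A" if "i \<ge> 1" for i
    using that
  proof (induction "Suc n - i" arbitrary: i rule: less_induct)
    case less
    show ?case
    proof (cases "i \<le> n")
      case True
      with less.prems have "Suc n - 2 * i < Suc n - i" "Suc n - (2 * i + 1) < Suc n - i" by auto
      from less.hyps[OF this(1)] less.hyps[OF this(2)] less.prems
      have "M 1 i \<le> Max ?A" "M 2 i \<le> Max ?A"
        using kept[of "2 * i"] kept[of "2 * i + 1"] by (auto simp: kept_max_def)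
      moreover have "M 0 i \<in> ?A"
        using True less.prems by (auto intro!: image_eqI[of _ _ "i - 1"])
      ultimately show ?thesis
        by (auto simp: node_max_def)
    next
      case False
      then show ?thesis
        using assms by (simp add: is_tree_def node_max_def)
    qed
  qed
  have "M 0 (Suc k) \<le> node_max M 1" for k
    using ge[of "Suc k"] by (simp add: node_max_def)
  then have "Max ?A \<le> node_max M 1"
    by auto
  moreover have "node_max M 1 \<le> Max ?A"
    by (rule le) simp
  ultimately show ?thesis
    unfolding root by (rule antisym[rotated])
qed

definition refresh :: "nat \<Rightarrow> (nat \<Rightarrow> nat \<Rightarrow> nat) \<Rightarrow> nat \<Rightarrow> nat \<Rightarrow> nat" where
  "refresh i M = (let b = if odd i then 2 else 1 in M(b := (M b)(i div 2 := node_max M i)))"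

text \<open>In this continuation form the two outcomes of the comparison are merged before the next
  instruction; the scratch register 9 is forgotten. \<open>Skip\<close> costs as much as the copy,
  so both branches take 3 steps.\<close>

lemma runs_max_into:
  assumes "x \<noteq> 9" "y \<noteq> 9"
    and "\<And>s'. reg s' x = max (reg s x) (reg s y) \<Longrightarrow> (\<And>r. r \<noteq> 9 \<Longrightarrow> r \<noteq> x \<Longrightarrow> reg s' r = reg s r) \<Longrightarrow>
      mem s' = mem s \<Longrightarrow> Q 3 s'"
  shows "runs w (max_into x y) s Q"
proof (cases "reg s x < reg s y")
  case True
  then show ?thesis
    using assms(1,2) assms(3)[of "set_reg x (reg s y) (set_reg 9 1 s)"]
    by (simp add: max_into_def numeral_3_eq_3)
next
  case False
  then show ?thesis
    using assms(1,2) assms(3)[of "set_reg 9 0 s"]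
    by (simp add: max_into_def numeral_3_eq_3)
qed

lemma runs_climb_step:
  assumes "reg s 6 = 1"
  shows "runs w climb_step s (\<lambda>t s'. t = 13 \<and> reg s' 6 = 1 \<and> reg s' 2 = reg s 2 div 2 \<and>
    reg s' 4 = reg s 4 \<and> mem s' = refresh (reg s 2) (mem s))"
  unfolding climb_step_def runs_Seq runs_Load
  apply (rule runs_max_into)
    apply simp
   apply simp
  apply simp
  apply (rule runs_max_into)
    apply simp
   apply simp
  using assms
  apply (cases "even (reg s 2)")
  apply (simp_all add: and_one_eq refresh_def node_max_def max.assoc odd_iff_mod_2_eq_one)
  done

text \<open>The equation of \<open>is_tree\<close> may fail only at the node in register 2. A step
  repairs it there and alters one record of the parent, so the defect moves to the parent and
  disappears at node 0. The index halves each time, hence at most \<open>l\<close> rounds of 13 + 1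
  steps.\<close>

lemma runs_climb:
  assumes "reg s 6 = 1" "reg s 2 < 2 ^ l" "reg s 2 \<le> n"
    and "\<And>j. j \<ge> 1 \<Longrightarrow> j \<noteq> reg s 2 \<Longrightarrow> kept_max (mem s) j = node_max (mem s) j"
    and "\<And>b i. b < 3 \<Longrightarrow> i > n \<Longrightarrow> mem s b i = 0"
  shows "runs w climb s (\<lambda>t s'. t \<le> 16 * l + 1 \<and> reg s' 4 = reg s 4 \<and>
    (\<forall>b. b \<noteq> 1 \<longrightarrow> b \<noteq> 2 \<longrightarrow> mem s' b = mem s b) \<and> is_tree n (mem s'))"
  using assms
proof (induction l arbitrary: s)
  case 0
  then show ?case
    by (subst runs_While) (auto simp: is_tree_def)
next
  case (Suc l)
  show ?case
  proof (cases "reg s 2 = 0")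
    case True
    with Suc.prems show ?thesis
      by (subst runs_While) (auto simp: is_tree_def)
  next
    case False
    define i where "i = reg s 2"
    have i: "i \<ge> 1" "i div 2 < 2 ^ l" "i div 2 \<le> n" "i div 2 \<noteq> i"
      using False Suc.prems by (auto simp: i_def)
    let ?M = "refresh i (mem s)"
    have step: "runs w climb s' (\<lambda>t s''. t \<le> 16 * l + 1 \<and> reg s'' 4 = reg s 4 \<and>
          (\<forall>b. b \<noteq> 1 \<longrightarrow> b \<noteq> 2 \<longrightarrow> mem s'' b = mem s b) \<and> is_tree n (mem s''))"
      if s': "reg s' 6 = 1" "reg s' 2 = i div 2" "reg s' 4 = reg s 4" "mem s' = ?M" for s' :: ram
    proof -
      have "runs w climb s' (\<lambda>t s''. t \<le> 16 * l + 1 \<and> reg s'' 4 = reg s' 4 \<and>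
          (\<forall>b. b \<noteq> 1 \<longrightarrow> b \<noteq> 2 \<longrightarrow> mem s'' b = mem s' b) \<and> is_tree n (mem s''))"
      proof (rule Suc.IH)
        fix j :: nat assume j: "j \<ge> 1" "j \<noteq> reg s' 2"
        have node: "node_max ?M j = node_max (mem s) j"
          using j(2) s'(2) by (auto simp: node_max_def refresh_def)
        show "kept_max (mem s') j = node_max (mem s') j"
        proof (cases "j = i")
          case True
          then show ?thesis
            using node s'(4) by (simp add: kept_max_def refresh_def)
        next
          case False
          \<comment> \<open>Distinct nodes keep their maxima in distinct places, so the record of
            \<open>j\<close> is untouched.\<close>
          then have "odd j \<noteq> odd i \<or> j div 2 \<noteq> i div 2"
            by (metis odd_two_times_div_two_succ even_two_times_div_two)
          then have "kept_max ?M j = kept_max (mem s) j"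
            by (auto simp: kept_max_def refresh_def)
          then show ?thesis
            using node s'(4) j False Suc.prems(4)[of j] by (simp add: i_def)
        qed
      next
        fix b m :: nat assume "b < 3" "n < m"
        then show "mem s' b m = 0"
          using s'(4) i(3) Suc.prems(5)[of b m] by (auto simp: refresh_def Let_def)
      qed (use s' i in auto)
      then show ?thesis
        by (rule runs_mono) (use s' in \<open>auto simp: refresh_def Let_def\<close>)
    qed
    have "runs w climb_step s (\<lambda>t s'. runs w climb s' (\<lambda>u s''. t + u + 1 \<le> 16 * Suc l + 1 \<and>
        reg s'' 4 = reg s 4 \<and> (\<forall>b. b \<noteq> 1 \<longrightarrow> b \<noteq> 2 \<longrightarrow> mem s'' b = mem s b) \<and> is_tree n (mem s'')))"
    proof (rule runs_mono[OF runs_climb_step[OF Suc.prems(1)]])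
      fix t :: nat and s' :: ram
      assume "t = 13 \<and> reg s' 6 = 1 \<and> reg s' 2 = reg s 2 div 2 \<and>
        reg s' 4 = reg s 4 \<and> mem s' = refresh (reg s 2) (mem s)"
      then show "runs w climb s' (\<lambda>u s''. t + u + 1 \<le> 16 * Suc l + 1 \<and> reg s'' 4 = reg s 4 \<and>
          (\<forall>b. b \<noteq> 1 \<longrightarrow> b \<noteq> 2 \<longrightarrow> mem s'' b = mem s b) \<and> is_tree n (mem s''))"
        by (intro runs_mono[OF step]) (auto simp: i_def)
    qed
    then show ?thesis
      using False by (subst runs_While) simp
  qed
qed

text \<open>The time is governed by \<open>l\<close>, the height of the tree, and not by the word
  length, which also grows with \<open>m\<close>.\<close>

lemma runs_add_code:
  assumes "reg s 4 = n" "is_tree n (mem s)" "n < 2 ^ l" "n < 2 ^ w" "w \<ge> 1"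
  shows "runs w add_code s (\<lambda>t s'. t \<le> 16 * l + 10 \<and> reg s' 4 = n \<and> is_tree n (mem s') \<and>
    mem s' 3 = mem s 3 \<and> mem s' 4 = mem s 4 \<and>
    (\<forall>k<n. mem s' 0 (Suc k) =
      (if k = reg s 2 then (mem s 0 (Suc k) + reg s 3) mod 2 ^ w else mem s 0 (Suc k))))"
proof (cases "reg s 2 < n")
  case False
  then show ?thesis
    using assms by (auto simp: add_code_def)
next
  case True
  define v where "v = (mem s 0 (Suc (reg s 2)) + reg s 3) mod 2 ^ w"
  have words: "1 mod 2 ^ w = (1 :: nat)" "Suc (reg s 2) mod 2 ^ w = Suc (reg s 2)"
    using True assms(4,5) by auto
  have climb: "runs w climb s' (\<lambda>t s''. t \<le> 16 * l + 1 \<and> reg s'' 4 = n \<and>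
      (\<forall>b. b \<noteq> 1 \<longrightarrow> b \<noteq> 2 \<longrightarrow> mem s'' b = mem s' b) \<and> is_tree n (mem s''))"
    if s': "reg s' 4 = n" "reg s' 6 = 1" "reg s' 2 = Suc (reg s 2)"
      "mem s' = (mem s)(0 := (mem s 0)(Suc (reg s 2) := v))" for s'
  proof -
    have "runs w climb s' (\<lambda>t s''. t \<le> 16 * l + 1 \<and> reg s'' 4 = reg s' 4 \<and>
        (\<forall>b. b \<noteq> 1 \<longrightarrow> b \<noteq> 2 \<longrightarrow> mem s'' b = mem s' b) \<and> is_tree n (mem s''))"
    proof (rule runs_climb)
      fix j :: nat assume "j \<ge> 1" "j \<noteq> reg s' 2"
      then show "kept_max (mem s') j = node_max (mem s') j"
        using assms(2) s' by (auto simp: is_tree_def kept_max_def node_max_def)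
    qed (use s' True assms in \<open>auto simp: is_tree_def\<close>)
    then show ?thesis
      unfolding s'(1) .
  qed
  have "runs w add_at (set_reg 5 1 s) (\<lambda>t s'. t + 2 \<le> 16 * l + 10 \<and> reg s' 4 = n \<and>
      is_tree n (mem s') \<and> mem s' 3 = mem s 3 \<and> mem s' 4 = mem s 4 \<and>
      mem s' 0 = (mem s 0)(Suc (reg s 2) := v))"
    unfolding add_at_def runs_Seq runs_Const runs_Op runs_Load runs_Store
    by (rule runs_mono[OF climb]) (use assms(1) words in \<open>auto simp: v_def\<close>)
  then have "runs w add_at (set_reg 5 1 s) (\<lambda>t s'. t + 2 \<le> 16 * l + 10 \<and> reg s' 4 = n \<and>
      is_tree n (mem s') \<and> mem s' 3 = mem s 3 \<and> mem s' 4 = mem s 4 \<and>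
      (\<forall>k<n. mem s' 0 (Suc k) =
      (if k = reg s 2 then (mem s 0 (Suc k) + reg s 3) mod 2 ^ w else mem s 0 (Suc k))))"
    by (rule runs_mono) (auto simp: v_def)
  then show ?thesis
    using True assms(1) by (simp add: add_code_def)
qed

text \<open>The cells hold totals over the whole timeline, that is, the present only. Banks 3 and 4
  remember what a later deletion has to undo.\<close>

definition represents :: "nat \<Rightarrow> nat \<Rightarrow> timeline \<Rightarrow> ram \<Rightarrow> bool" where
  "represents w n L s \<longleftrightarrow> reg s 4 = n \<and> is_tree n (mem s) \<and>
     (\<forall>k<n. mem s 0 (Suc k) = added k (map snd L) mod 2 ^ w) \<and>
     (\<forall>(a, u) \<in> set L. a \<noteq> 0 \<and> mem s 3 a = u ! 0 \<and> mem s 4 a = u ! 1) \<and>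
     distinct (map fst L)"

section \<open>The tree under edits of the timeline\<close>

lemma edit_Insert_split:
  obtains L1 L2 where "L = L1 @ L2" "edit (Insert p a u) L = L1 @ (a, u) # L2"
  using prefix_until_append_drop[of p L] by (metis edit.simps(1))

lemma edit_Delete_split:
  assumes "distinct (map fst L)" "a \<in> fst ` set L"
  obtains u L1 L2 where "L = L1 @ (a, u) # L2" "edit (Delete a) L = L1 @ L2"
proof -
  from assms(2) obtain u where "(a, u) \<in> set L" by auto
  then obtain L1 L2 where L: "L = L1 @ (a, u) # L2" by (meson split_list)
  then have "filter (\<lambda>e. fst e \<noteq> a) L1 = L1" "filter (\<lambda>e. fst e \<noteq> a) L2 = L2"
    using assms(1) by (force simp: filter_id_conv)+
  then show thesis
    using that L by simp
qed

lemma max_tree_op: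
  assumes rep: "represents w n L s" and legal: "legal Partial max_problem m w L x"
    and n: "n < 2 ^ l" "n < 2 ^ w" "w \<ge> 1"
  shows "runs w (fst (call max_tree x)) (pass (snd (call max_tree x)) s)
    (\<lambda>t s'. t \<le> 16 * l + 20 \<and> correct max_problem w n L x (reg s' 0) \<and> represents w n (edit x L) s')"
proof (cases x)
  case (Insert p a u)
  obtain L1 L2 where L: "L = L1 @ L2" "edit x L = L1 @ (a, u) # L2"
    unfolding Insert by (rule edit_Insert_split)
  have a: "a \<noteq> 0" "a \<notin> fst ` set L" and u: "length u = 2"
    using legal by (auto simp: Insert points_def words_def)
  let ?s = "set_mem 4 a (u ! 1) (set_mem 3 a (u ! 0) (pass (p # a # u) s))"
  have "runs w add_code ?s (\<lambda>t s'. t + 2 \<le> 16 * l + 20 \<and> represents w n (edit x L) s')"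
  proof (rule runs_mono[OF runs_add_code[OF _ _ n]])
    show "reg ?s 4 = n"
      using rep u by (simp add: represents_def)
    show "is_tree n (mem ?s)"
      using rep is_tree_cong[of "mem ?s" "mem s" n] by (simp add: represents_def)
  next
    fix t :: nat and s' :: ram
    assume s': "t \<le> 16 * l + 10 \<and> reg s' 4 = n \<and> is_tree n (mem s') \<and>
      mem s' 3 = mem ?s 3 \<and> mem s' 4 = mem ?s 4 \<and>
      (\<forall>k<n. mem s' 0 (Suc k) =
        (if k = reg ?s 2 then (mem ?s 0 (Suc k) + reg ?s 3) mod 2 ^ w else mem ?s 0 (Suc k)))"
    have "\<forall>k<n. mem s' 0 (Suc k) = added k (map snd (edit x L)) mod 2 ^ w"
      using s' rep u L by (auto simp: represents_def mod_simps ac_simps numeral_3_eq_3 numeral_2_eq_2)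
    moreover have "\<forall>(b, v) \<in> set (edit x L). b \<noteq> 0 \<and> mem s' 3 b = v ! 0 \<and> mem s' 4 b = v ! 1"
    proof (rule ballI, rule case_prodI2)
      fix e b v assume e: "e \<in> set (edit x L)" "e = (b, v)"
      show "b \<noteq> 0 \<and> mem s' 3 b = v ! 0 \<and> mem s' 4 b = v ! 1"
      proof (cases "e = (a, u)")
        case True
        then show ?thesis
          using s' a(1) e(2) by simp
      next
        case False
        then have "(b, v) \<in> set L"
          using e L by auto
        moreover from this have "b \<noteq> a"
          using a(2) by force
        ultimately show ?thesis
          using s' rep by (auto simp: represents_def)
      qed
    qed
    moreover have "distinct (map fst (edit x L))"
      using rep L a(2) by (auto simp: represents_def)
    ultimately show "t + 2 \<le> 16 * l + 20 \<and> represents w n (edit x L) s'"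
      using s' by (simp add: represents_def)
  qed
  then show ?thesis
    using u by (simp add: Insert max_tree_def numeral_3_eq_3 numeral_2_eq_2)
next
  case (Delete a)
  obtain u L1 L2 where L: "L = L1 @ (a, u) # L2" "edit x L = L1 @ L2"
    unfolding Delete using rep legal
    by (rule_tac edit_Delete_split) (auto simp: represents_def Delete)
  have u: "mem s 3 a = u ! 0" "mem s 4 a = u ! 1"
    using rep L by (auto simp: represents_def)
  let ?s = "set_reg 3 (nat (- int (u ! 1) mod 2 ^ w))
    (set_reg 5 0 (set_reg 3 (u ! 1) (set_reg 2 (u ! 0) (pass [a] s))))"
  have "runs w add_code ?s (\<lambda>t s'. t + 4 \<le> 16 * l + 20 \<and> represents w n (edit x L) s')"
  proof (rule runs_mono[OF runs_add_code[OF _ _ n]])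
    show "reg ?s 4 = n" "is_tree n (mem ?s)"
      using rep by (simp_all add: represents_def)
  next
    fix t :: nat and s' :: ram
    assume s': "t \<le> 16 * l + 10 \<and> reg s' 4 = n \<and> is_tree n (mem s') \<and>
      mem s' 3 = mem ?s 3 \<and> mem s' 4 = mem ?s 4 \<and>
      (\<forall>k<n. mem s' 0 (Suc k) =
        (if k = reg ?s 2 then (mem ?s 0 (Suc k) + reg ?s 3) mod 2 ^ w else mem ?s 0 (Suc k)))"
    \<comment> \<open>In the cell of the deleted update, its contribution and the added complement
      cancel.\<close>
    have "mem s' 0 (Suc k) = added k (map snd (edit x L)) mod 2 ^ w" if "k < n" for k
    proof (cases "k = u ! 0")
      case True
      then show ?thesis
        using that s' rep L nat_mod_add_sub[of "added k (map snd (edit x L))" "u ! 1" w]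
        by (simp add: represents_def mod_simps ac_simps)
    next
      case False
      then show ?thesis
        using that s' rep L by (simp add: represents_def)
    qed
    then show "t + 4 \<le> 16 * l + 20 \<and> represents w n (edit x L) s'"
      using s' rep L by (auto simp: represents_def)
  qed
  then show ?thesis
    using u by (simp add: Delete max_tree_def)
next
  case (Query p q)
  have "q = []" "p = present L"
    using legal by (auto simp: Query words_def)
  moreover have "prefix_until (present L) L = L"
    using rep by (intro prefix_until_present) (auto simp: represents_def)
  moreover have "Max (insert 0 ((\<lambda>k. added k (map snd L) mod 2 ^ w) ` {..<n})) = mem s 2 0"
  proof -
    have "(\<lambda>k. added k (map snd L) mod 2 ^ w) ` {..<n} = (\<lambda>k. mem s 0 (Suc k)) ` {..<n}"
      using rep by (intro image_cong) (auto simp: represents_def)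
    with tree_root[of n "mem s"] rep show ?thesis
      by (simp add: represents_def)
  qed
  ultimately show ?thesis
    using rep by (simp add: Query max_tree_def Max_state_at represents_def)
qed

lemma max_tree_operates:
  assumes "n < 2 ^ l" "n < 2 ^ w" "w \<ge> 1"
  shows "represents w n L s \<Longrightarrow> legal_ops Partial max_problem m w L xs \<Longrightarrow>
    \<exists>ts. operates max_problem n w max_tree L s xs ts \<and> (\<forall>t\<in>set ts. t \<le> 16 * l + 20)"
proof (induction xs arbitrary: L s)
  case (Cons x xs)
  from Cons.prems have "runs w (fst (call max_tree x)) (pass (snd (call max_tree x)) s)
    (\<lambda>t s'. t \<le> 16 * l + 20 \<and> correct max_problem w n L x (reg s' 0) \<and> represents w n (edit x L) s')"
    by (intro max_tree_op[OF _ _ assms]) auto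
  then obtain t s' where "exec w (fst (call max_tree x)) (pass (snd (call max_tree x)) s) t s'"
    "t \<le> 16 * l + 20" "correct max_problem w n L x (reg s' 0)" "represents w n (edit x L) s'"
    unfolding runs_def by blast
  moreover from Cons.IH[OF this(4)] Cons.prems(2) obtain ts where
    "operates max_problem n w max_tree (edit x L) s' xs ts" "\<forall>t\<in>set ts. t \<le> 16 * l + 20"
    by auto
  ultimately show ?case
    by (intro exI[of _ "t # ts"]) auto
qed simp

lemma max_tree_retroactive:
  assumes n: "n \<ge> 2" "n < 2 ^ w"
  shows "retroactive_ds Partial max_problem n m w max_tree (worst_case n (52 * log 2 (real n)))"
proof -
  obtain l where l: "2 ^ l \<le> n" "n < 2 ^ (l + 1)"
    using ex_power_ivl1[of 2 n] n by auto
  have "log 2 (2 ^ l) \<le> log 2 (real n)"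
    using l(1) n by (subst log_le_cancel_iff) (auto simp flip: of_nat_le_iff)
  then have "real l \<le> log 2 (real n)"
    by simp
  moreover have "1 \<le> log 2 (real n)"
    using n by simp
  \<comment> \<open>The left side is 16 * l + 36, and both \<open>l\<close> and 1 are at most
    \<open>log 2 n\<close>; 16 + 36 = 52.\<close>
  ultimately have bound: "real (16 * (l + 1) + 20) \<le> 52 * log 2 (real n)"
    by simp
  have w: "w \<ge> 1"
    using n by (cases w) auto
  have exec: "exec w (init_code max_tree) (pass [n] blank) 1 (set_reg 4 n (pass [n] blank))"
    using exec.Op[of w 4 Or 0 0 "pass [n] blank"] by (simp add: max_tree_def)
  have init: "represents w n [] (set_reg 4 n (pass [n] blank))"
    by (auto simp: represents_def is_tree_def kept_max_def node_max_def blank_def)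
  have time: "1 \<le> (real n + 1) * (52 * log 2 (real n))"
    using mult_mono[of 1 "real n + 1" 1 "52 * log 2 (real n)"] \<open>1 \<le> log 2 (real n)\<close> by simp
  show ?thesis
    unfolding retroactive_ds_def
  proof (rule exI[of _ 1], rule exI[of _ "set_reg 4 n (pass [n] blank)"], intro conjI allI impI)
    show "exec w (init_code max_tree) (pass [n] blank) 1 (set_reg 4 n (pass [n] blank))"
      by (rule exec)
  next
    fix xs assume "legal_ops Partial max_problem m w [] xs"
    from max_tree_operates[OF l(2) n(2) w init this] obtain ts where ts:
      "operates max_problem n w max_tree [] (set_reg 4 n (pass [n] blank)) xs ts"
      "\<forall>t\<in>set ts. t \<le> 16 * (l + 1) + 20"
      by blast
    have "real t \<le> 52 * log 2 (real n)" if "t \<in> set ts" for t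
      using ts(2) that bound by (meson of_nat_mono order_trans)
    with ts(1) time show "\<exists>ts. operates max_problem n w max_tree [] (set_reg 4 n (pass [n] blank)) xs ts \<and>
        worst_case n (52 * log 2 (real n)) 1 ts"
      by (auto simp: worst_case_def)
  qed
qed

subsection \<open>Running a data structure inside another program\<close>

text \<open>The guest \<open>s\<close> is shifted above the first \<open>\<rho>\<close> registers
  and \<open>\<beta>\<close> banks of the host \<open>S\<close>. Both are complete machine states,
  so facts about the guest running alone can be quoted as they are.\<close>

definition overlay :: "nat \<Rightarrow> nat \<Rightarrow> ram \<Rightarrow> ram \<Rightarrow> ram" where
  "overlay \<rho> \<beta> s S =
     \<lparr>reg = (\<lambda>r. if r < \<rho> then reg S r else reg s (r - \<rho>)),
      mem = (\<lambda>b. if b < \<beta> then mem S b else mem s (b - \<beta>))\<rparr>"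

primrec relocate :: "nat \<Rightarrow> nat \<Rightarrow> program \<Rightarrow> program" where
  "relocate \<rho> \<beta> Skip = Skip"
| "relocate \<rho> \<beta> (Const r k) = Const (r + \<rho>) k"
| "relocate \<rho> \<beta> (Op r f x y) = Op (r + \<rho>) f (x + \<rho>) (y + \<rho>)"
| "relocate \<rho> \<beta> (Load r b a) = Load (r + \<rho>) (b + \<beta>) (a + \<rho>)"
| "relocate \<rho> \<beta> (Store b a r) = Store (b + \<beta>) (a + \<rho>) (r + \<rho>)"
| "relocate \<rho> \<beta> (Seq p q) = Seq (relocate \<rho> \<beta> p) (relocate \<rho> \<beta> q)"
| "relocate \<rho> \<beta> (If r p q) = If (r + \<rho>) (relocate \<rho> \<beta> p) (relocate \<rho> \<beta> q)"
| "relocate \<rho> \<beta> (While r p) = While (r + \<rho>) (relocate \<rho> \<beta> p)"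

lemma reg_overlay [simp]: "reg (overlay \<rho> \<beta> s S) r = (if r < \<rho> then reg S r else reg s (r - \<rho>))"
  and mem_overlay [simp]: "mem (overlay \<rho> \<beta> s S) b = (if b < \<beta> then mem S b else mem s (b - \<beta>))"
  by (simp_all add: overlay_def)

lemma set_reg_overlay [simp]:
  "set_reg r x (overlay \<rho> \<beta> s S) =
     (if r < \<rho> then overlay \<rho> \<beta> s (set_reg r x S) else overlay \<rho> \<beta> (set_reg (r - \<rho>) x s) S)"
  by (auto simp: overlay_def set_reg_def fun_eq_iff)

lemma set_mem_overlay [simp]:
  "set_mem b a x (overlay \<rho> \<beta> s S) =
     (if b < \<beta> then overlay \<rho> \<beta> s (set_mem b a x S) else overlay \<rho> \<beta> (set_mem (b - \<beta>) a x s) S)"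
  by (auto simp: overlay_def set_mem_def fun_eq_iff)

text \<open>Only numbers of registers and banks are shifted, and these are constants of the program;
  addresses inside a bank stay the same. Hence there is no overhead at all.\<close>

lemma exec_relocate:
  "exec w p s t s' \<Longrightarrow> exec w (relocate \<rho> \<beta> p) (overlay \<rho> \<beta> s S) t (overlay \<rho> \<beta> s' S)"
proof (induction rule: exec.induct)
  case (Const r k s)
  then show ?case
    using exec.Const[of w "r + \<rho>" k "overlay \<rho> \<beta> s S"] by simp
next
  case (Op r f x y s)
  then show ?case
    using exec.Op[of w "r + \<rho>" f "x + \<rho>" "y + \<rho>" "overlay \<rho> \<beta> s S"] by simp
next
  case (Load r b a s)
  then show ?case
    using exec.Load[of w "r + \<rho>" "b + \<beta>" "a + \<rho>" "overlay \<rho> \<beta> s S"] by simp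
next
  case (Store b a r s)
  then show ?case
    using exec.Store[of w "b + \<beta>" "a + \<rho>" "r + \<rho>" "overlay \<rho> \<beta> s S"] by simp
next
  case (IfTrue s r p t s' q)
  then show ?case
    by (auto intro!: exec.IfTrue[simplified])
next
  case (IfFalse s r q t s' p)
  then show ?case
    by (auto intro!: exec.IfFalse[simplified])
next
  case (WhileTrue s r p t s' u s'')
  have "reg (overlay \<rho> \<beta> s S) (r + \<rho>) \<noteq> 0"
    using WhileTrue.hyps by simp
  from exec.WhileTrue[OF this WhileTrue.IH(1)] WhileTrue.IH(2) show ?case
    by simp
next
  case (WhileFalse s r p)
  then show ?case
    using exec.WhileFalse[of "overlay \<rho> \<beta> s S" "r + \<rho>" w "relocate \<rho> \<beta> p"] by simp
next
  case (Skip s)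
  show ?case
    using exec.Skip[of w] by simp
qed (auto intro: exec.intros)

lemma set_reg_twice [simp]: "set_reg r x (set_reg r y s) = set_reg r x s"
  by (simp add: set_reg_def)

lemma pass_1: "pass [x] s = set_reg 0 x s"
  by (auto simp: pass_def set_reg_def fun_eq_iff)

lemma pass_4: "pass [p, a, x, y] s = set_reg 3 y (set_reg 2 x (set_reg (Suc 0) a (set_reg 0 p s)))"
  by (auto simp: pass_def set_reg_def fun_eq_iff less_Suc_eq numeral_3_eq_3 numeral_2_eq_2)

lemma operates_length: "operates P n w D L s xs ts \<Longrightarrow> length ts = length xs"
  by (induction xs arbitrary: L s ts) auto

text \<open>The cost of a call is taken off the time that the structure will spend on
  \<open>x # xs\<close>; this remaining time is the budget in \<open>runs_countdown\<close>.\<close>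

lemma runs_relocate_call:
  assumes "operates P n w D L s (x # xs) ts"
    and "\<And>t s' ts'. correct P w n L x (reg s' 0) \<Longrightarrow> operates P n w D (edit x L) s' xs ts' \<Longrightarrow>
      sum_list ts = t + sum_list ts' \<Longrightarrow> Q t (overlay \<rho> \<beta> s' S)"
  shows "runs w (relocate \<rho> \<beta> (fst (call D x))) (overlay \<rho> \<beta> (pass (snd (call D x)) s) S) Q"
proof -
  from assms(1) obtain t s' ts' where t: "exec w (fst (call D x)) (pass (snd (call D x)) s) t s'"
    and r: "correct P w n L x (reg s' 0)" "operates P n w D (edit x L) s' xs ts'" "ts = t # ts'"
    by auto
  have "Q t (overlay \<rho> \<beta> s' S)"
    using assms(2)[of s' ts' t] r by simp
  with exec_relocate[OF t] show ?thesis
    unfolding runs_def by blast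
qed

lemmas runs_relocate_insert =
  runs_relocate_call[where x = "Insert p a [x, y]" for p a x y, simplified call.simps fst_conv snd_conv pass_4]
lemmas runs_relocate_delete =
  runs_relocate_call[where x = "Delete a" for a, simplified call.simps fst_conv snd_conv pass_1]
lemmas runs_relocate_query =
  runs_relocate_call[where x = "Query p []" for p, simplified call.simps fst_conv snd_conv pass_1]

subsection \<open>Computing products with a fully retroactive data structure\<close>

text \<open>
  The data structure occupies the registers from 16 and the banks from 3. Below that, register 0
  holds the dimension \<open>d\<close>, 2 is the loop counter, and 5 holds the constant 1; while a vector is
  processed, 6 holds \<open>d * d\<close>, the last name of a matrix update, and 7 the number \<open>half\<close> defined below.
  All insertions are made at the beginning of the timeline, in reverse order. In row 0 the address
  of the entry above is negative; it wraps around to a cell beyond the matrix, which contains 0.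
\<close>

definition insert_entry :: "data_structure \<Rightarrow> program" where
  "insert_entry D =
     Op 2 Sub 2 5 ;; Op 3 Sub 2 0 ;; Load 3 0 3 ;; Load 4 0 2 ;;
     Const 16 0 ;; Op 17 Add 2 5 ;; Op 18 Mod 2 0 ;; Op 19 Sub 3 4 ;; relocate 16 3 (insert_code D)"

text \<open>The size \<open>K * d + r\<close> is computed from \<open>d\<close>, so for each
  \<open>r\<close> one fixed program serves all dimensions. Register 16 is register 0 of the
  structure, where it expects its argument.\<close>

definition prep_code :: "data_structure \<Rightarrow> nat \<Rightarrow> nat \<Rightarrow> program" where
  "prep_code D K r =
     Const 1 K ;; Op 1 Mul 1 0 ;; Const 2 r ;; Op 16 Add 1 2 ;; relocate 16 3 (init_code D) ;;
     Const 5 1 ;; Op 2 Mul 0 0 ;; While 2 (insert_entry D)"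

definition insert_coordinate :: "data_structure \<Rightarrow> program" where
  "insert_coordinate D =
     Op 2 Sub 2 5 ;; Load 3 1 2 ;; Const 16 0 ;; Op 17 Add 6 2 ;; Op 17 Add 17 5 ;;
     Op 18 Or 2 2 ;; Op 19 Sub 7 3 ;; relocate 16 3 (insert_code D)"

text \<open>The point is computed before the counter drops, as the last update of row
  \<open>j\<close> is named \<open>Suc j * d\<close>.\<close>

definition query_row :: "data_structure \<Rightarrow> program" where
  "query_row D =
     Op 16 Mul 2 0 ;; Op 2 Sub 2 5 ;; relocate 16 3 (query_code D) ;; Op 3 Sub 7 16 ;; Store 2 2 3"

definition delete_coordinate :: "data_structure \<Rightarrow> program" where
  "delete_coordinate D =
     Op 2 Sub 2 5 ;; Op 16 Add 6 2 ;; Op 16 Add 16 5 ;; relocate 16 3 (delete_code D)"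

text \<open>The program is not told the word length: 0 - 1 wraps around to the word of all ones, and
  a shift turns it into \<open>half\<close>.\<close>

definition step_code :: "data_structure \<Rightarrow> program" where
  "step_code D =
     Op 6 Mul 0 0 ;; Const 7 0 ;; Op 7 Sub 7 5 ;; Op 7 Shr 7 5 ;;
     Op 2 Or 0 0 ;; While 2 (insert_coordinate D) ;;
     Op 2 Or 0 0 ;; While 2 (query_row D) ;;
     Op 2 Or 0 0 ;; While 2 (delete_coordinate D)"

section \<open>Word arithmetic and loops over operations\<close>

lemma int_encode [simp]: "int (encode w x) = x mod 2 ^ w"
  by (simp add: encode_def)

lemma word_sub_less: "word_op w Sub x y < 2 ^ w"
  by (simp add: nat_less_iff)

lemma word_sub: "y \<le> x \<Longrightarrow> x < 2 ^ w \<Longrightarrow> word_op w Sub x y = x - y"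
  by (simp flip: of_nat_diff)

lemma int_word_sub: "int (word_op w Sub x y) = (int x - int y) mod 2 ^ w"
  by simp

lemma legal_ops_append:
  "legal_ops k P m w L (xs @ ys) \<longleftrightarrow> legal_ops k P m w L xs \<and> legal_ops k P m w (fold edit xs L) ys"
  by (induction xs arbitrary: L) auto

lemma countdown_ops:
  assumes "\<And>i. i < N \<Longrightarrow> edit (op i) (L (Suc i)) = L i"
  shows "fold edit (map op (rev [0..<N])) (L N) = L 0"
    and "(\<And>i. i < N \<Longrightarrow> legal k P m w (L (Suc i)) (op i)) \<Longrightarrow>
      legal_ops k P m w (L N) (map op (rev [0..<N]))"
  using assms by (induction N) auto

text \<open>The structure is known only through \<open>operates\<close>: \<open>xs\<close> are the
  operations ahead of it and \<open>\<phi>\<close> is the time it will spend on them.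
  \<open>F\<close> is the invariant of the host.\<close>

definition running ::
  "data_structure \<Rightarrow> nat \<Rightarrow> nat \<Rightarrow> timeline \<Rightarrow> retro_op list \<Rightarrow> (ram \<Rightarrow> bool) \<Rightarrow> ram \<Rightarrow> nat \<Rightarrow> bool"
where
  "running D n w L xs F s0 \<phi> \<longleftrightarrow> (\<exists>s S ts. s0 = overlay 16 3 s S \<and> F S \<and>
     operates max_problem n w D L s xs ts \<and> \<phi> = sum_list ts)"

lemma runningI:
  "F S \<Longrightarrow> operates max_problem n w D L s xs ts \<Longrightarrow> running D n w L xs F (overlay 16 3 s S) (sum_list ts)"
  unfolding running_def by blast

lemma running_mono: "running D n w L xs F s0 \<phi> \<Longrightarrow> (\<And>S. F S \<Longrightarrow> F' S) \<Longrightarrow> running D n w L xs F' s0 \<phi>"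
  unfolding running_def by blast

lemma running_reg: "running D n w L xs F s0 \<phi> \<Longrightarrow> (\<And>S. F S \<Longrightarrow> reg S r = x) \<Longrightarrow> r < 16 \<Longrightarrow> reg s0 r = x"
  unfolding running_def by auto

lemma running_mem: "running D n w L xs F s0 \<phi> \<Longrightarrow> (\<And>S. F S \<Longrightarrow> mem S b a = x) \<Longrightarrow> b < 3 \<Longrightarrow> mem s0 b a = x"
  unfolding running_def by auto

lemma running_set_reg:
  "running D n w L xs F s0 \<phi> \<Longrightarrow> r < 16 \<Longrightarrow> (\<And>S. F S \<Longrightarrow> F' (set_reg r x S)) \<Longrightarrow>
    running D n w L xs F' (set_reg r x s0) \<phi>"
  unfolding running_def by fastforce

lemma running_load_vector:
  "running D n w L xs F s0 \<phi> \<Longrightarrow> (\<And>S. F S \<Longrightarrow> F' (load_vector w d v S)) \<Longrightarrow>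
    running D n w L xs F' (load_vector w d v s0) \<phi>"
  unfolding running_def
proof (elim exE conjE, goal_cases)
  case (1 s S ts)
  then show ?case
    by (intro exI[of _ s] exI[of _ "load_vector w d v S"] exI[of _ ts])
      (auto simp: overlay_def load_vector_def fun_eq_iff)
qed

lemma running_countdown:
  assumes "\<And>i s \<phi>. running D n w (L (Suc i)) (op i # map op (rev [0..<i]) @ xs) (F (Suc i)) s \<phi> \<Longrightarrow>
      runs w p s (\<lambda>t s'. \<exists>\<phi>'.
        running D n w (L i) (map op (rev [0..<i]) @ xs) (F i) s' \<phi>' \<and> t + \<phi>' \<le> c + \<phi>)"
    and "\<And>i S. F i S \<Longrightarrow> reg S r = i" and "r < 16"
    and "running D n w (L N) (map op (rev [0..<N]) @ xs) (F N) s0 \<phi>"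
  shows "runs w (While r p) s0 (\<lambda>t s'. \<exists>\<phi>'.
    running D n w (L 0) xs (F 0) s' \<phi>' \<and> t + \<phi>' \<le> (c + 1) * N + 1 + \<phi>)"
proof -
  let ?Inv = "\<lambda>i. running D n w (L i) (map op (rev [0..<i]) @ xs) (F i)"
  have body: "runs w p s (\<lambda>t s'. \<exists>\<phi>'. ?Inv i s' \<phi>' \<and> t + \<phi>' \<le> c + \<phi>)"
    if "?Inv (Suc i) s \<phi>" for i s \<phi>
    using assms(1) that by simp
  have counter: "reg s r = i" if "?Inv i s \<phi>" for i s \<phi>
    using that assms(2,3) by (rule running_reg)
  show ?thesis
    using runs_countdown[where Inv = ?Inv and k = N and s = s0 and \<phi> = \<phi>, OF body counter] assms(4) by simp
qed

text \<open>The bound on \<open>m\<close> admits the \<open>d * d\<close> matrix updates and one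
  vector. It also makes their names, which go up to \<open>d * d + d\<close>, words.\<close>

locale reduction =
  fixes w n d m :: nat and D :: data_structure and A :: "nat \<Rightarrow> nat \<Rightarrow> int"
  assumes d: "1 \<le> d" "d \<le> n" and n: "n < 2 ^ w" and m: "d * d + d \<le> m" "m < 2 ^ w"
    and A: "\<And>j k. j < d \<Longrightarrow> k < d \<Longrightarrow> entry w (A j k)"
begin

definition cell :: "nat \<Rightarrow> nat" where
  "cell t = (if t < d * d then encode w (A (t div d) (t mod d)) else 0)"

text \<open>After the updates of row \<open>j\<close>, coordinate \<open>k\<close> of the array has changed by \<open>- A j k\<close> in total.\<close>

definition entry_update :: "nat \<Rightarrow> nat \<times> nat list" where
  "entry_update t =
     (Suc t, [t mod d, word_op w Sub (if t < d then 0 else cell (t - d)) (cell t)])"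

text \<open>This is \<open>2 ^ (w - 1) - 1\<close>. A sum \<open>x\<close> of two entries lies
  between \<open>- (2 ^ (w - 1))\<close> and \<open>half\<close>, so \<open>half - x\<close> ranges
  exactly over the words.\<close>

definition half :: nat where
  "half = (2 ^ w - 1) div 2"

text \<open>
  The sum \<open>x\<close> of two entries is recorded as \<open>half - x\<close>, which is nonnegative: maxima of words thus
  give minima of integers.
\<close>

definition coordinate_update :: "(nat \<Rightarrow> int) \<Rightarrow> nat \<Rightarrow> nat \<times> nat list" where
  "coordinate_update v k = (Suc (d * d + k), [k, word_op w Sub half (encode w (v k))])"

definition rows :: timeline where
  "rows = map entry_update [0..<d * d]"

definition entry_op :: "nat \<Rightarrow> retro_op" where
  "entry_op t = Insert 0 (fst (entry_update t)) (snd (entry_update t))"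

definition coordinate_op :: "(nat \<Rightarrow> int) \<Rightarrow> nat \<Rightarrow> retro_op" where
  "coordinate_op v k = Insert 0 (fst (coordinate_update v k)) (snd (coordinate_update v k))"

definition row_query :: "nat \<Rightarrow> retro_op" where
  "row_query j = Query (Suc j * d) []"

definition coordinate_deletion :: "nat \<Rightarrow> retro_op" where
  "coordinate_deletion k = Delete (Suc (d * d + k))"

definition matrix_ops :: "retro_op list" where
  "matrix_ops = map entry_op (rev [0..<d * d])"

definition vector_ops :: "(nat \<Rightarrow> int) \<Rightarrow> retro_op list" where
  "vector_ops v = map (coordinate_op v) (rev [0..<d]) @ map row_query (rev [0..<d]) @
     map coordinate_deletion (rev [0..<d])"

section \<open>Legality and effect of the operations\<close>

lemma prefix_until_0 [simp]: "prefix_until 0 L = []"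
  by (cases L) auto

lemma edit_entry_op: "i < d * d \<Longrightarrow>
    edit (entry_op i) (map entry_update [Suc i..<d * d]) = map entry_update [i..<d * d]"
  by (simp add: entry_op_def upt_conv_Cons)

lemma edit_coordinate_op: "i < d \<Longrightarrow>
    edit (coordinate_op v i) (map (coordinate_update v) [Suc i..<d] @ rows) =
      map (coordinate_update v) [i..<d] @ rows"
  by (simp add: coordinate_op_def upt_conv_Cons)

lemma edit_row_query: "edit (row_query j) L = L"
  by (simp add: row_query_def)

lemma edit_coordinate_deletion: "i < d \<Longrightarrow>
    edit (coordinate_deletion i) (map (coordinate_update v) [0..<Suc i] @ rows) =
      map (coordinate_update v) [0..<i] @ rows"
  by (auto simp: coordinate_deletion_def coordinate_update_def rows_def entry_update_def
      filter_id_conv filter_empty_conv)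

lemma mod_less_word: "t mod d < 2 ^ w"
  using d n by (meson le_less_trans less_imp_le mod_less_divisor less_le_trans zero_less_one)

lemma legal_matrix_ops:
  "legal_ops Full max_problem m w [] matrix_ops"
  "fold edit matrix_ops [] = rows"
proof -
  have "legal Full max_problem m w (map entry_update [Suc i..<d * d]) (entry_op i)"
    if "i < d * d" for i
    using that m mod_less_word word_sub_less
    by (auto simp: entry_op_def entry_update_def points_def words_def simp del: word_op.simps)
  then show "legal_ops Full max_problem m w [] matrix_ops"
    using countdown_ops(2)[where L = "\<lambda>i. map entry_update [i..<d * d]" and N = "d * d" and op = entry_op,
        OF edit_entry_op]
    by (simp add: matrix_ops_def)
  show "fold edit matrix_ops [] = rows"
    using countdown_ops(1)[where L = "\<lambda>i. map entry_update [i..<d * d]" and N = "d * d" and op = entry_op,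
        OF edit_entry_op]
    by (simp add: matrix_ops_def rows_def)
qed

lemma legal_vector_ops:
  "legal_ops Full max_problem m w rows (vector_ops v)"
  "fold edit (vector_ops v) rows = rows"
proof -
  let ?c = "coordinate_update v"
  have ins: "legal Full max_problem m w (map ?c [Suc i..<d] @ rows) (coordinate_op v i)"
    if "i < d" for i
    using that m d n word_sub_less
    by (auto simp: coordinate_op_def coordinate_update_def rows_def entry_update_def points_def
        words_def simp del: word_op.simps)
  have query: "legal Full max_problem m w (map ?c [0..<d] @ rows) (row_query j)" if "j < d" for j
  proof -
    have "Suc j * d \<le> d * d" "0 < Suc j * d"
      using that d by (simp_all add: mult_le_mono1 del: mult_Suc)
    \<comment> \<open>The index of the last update of row \<open>j\<close>; names are indices plus
      one.\<close>
    then have "Suc j * d - 1 \<in> {0..<d * d}" "Suc j * d = Suc (Suc j * d - 1)"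
      by auto
    then have "Suc j * d \<in> fst ` set rows"
      unfolding rows_def set_map set_upt image_image entry_update_def fst_conv by (rule rev_image_eqI)
    then show ?thesis
      by (auto simp: row_query_def points_def words_def)
  qed
  have del: "legal Full max_problem m w (map ?c [0..<Suc i] @ rows) (coordinate_deletion i)"
    if "i < d" for i
    by (simp add: coordinate_deletion_def coordinate_update_def)
  note ins_ops = countdown_ops[where L = "\<lambda>i. map ?c [i..<d] @ rows" and N = d and
      op = "coordinate_op v", OF edit_coordinate_op]
  note query_ops = countdown_ops[where L = "\<lambda>_. map ?c [0..<d] @ rows" and N = d and
      op = row_query, OF edit_row_query]
  note del_ops = countdown_ops[where L = "\<lambda>i. map ?c [0..<i] @ rows" and N = d and
      op = coordinate_deletion, OF edit_coordinate_deletion]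
  show "legal_ops Full max_problem m w rows (vector_ops v)"
    using ins_ops(1) ins_ops(2)[OF _ ins] query_ops(1) query_ops(2)[OF query] del_ops(2)[OF _ del]
    by (simp add: vector_ops_def legal_ops_append)
  show "fold edit (vector_ops v) rows = rows"
    using ins_ops(1) query_ops(1) del_ops(1) by (simp add: vector_ops_def)
qed

text \<open>Every vector leaves \<open>rows\<close> behind, so the room needed on the timeline does
  not grow with the number of vectors.\<close>

lemma legal_all_ops: "legal_ops Full max_problem m w [] (matrix_ops @ concat (map vector_ops vs))"
proof -
  have "legal_ops Full max_problem m w rows (concat (map vector_ops vs))"
    by (induction vs) (simp_all add: legal_ops_append legal_vector_ops)
  then show ?thesis
    by (simp add: legal_ops_append legal_matrix_ops)
qed

lemma length_all_ops: "length (matrix_ops @ concat (map vector_ops vs)) = d * d + 3 * d * length vs"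
  by (induction vs) (simp_all add: matrix_ops_def vector_ops_def)

section \<open>The answer to a query after a row\<close>

lemma word_length_pos: "w \<ge> 1"
  using n d by (cases w) auto

lemma two_half: "2 * int half + 2 = 2 ^ w"
proof -
  obtain w' where "w = Suc w'"
    using word_length_pos by (cases w) auto
  moreover have "int half = (2 ^ w - 1) div 2"
    by (simp add: half_def zdiv_int of_nat_diff)
  moreover have "(2 * x - 1) div 2 = x - 1" for x :: int
    by linarith
  ultimately show ?thesis
    by simp
qed

lemma word_bounds: "t < d * d \<Longrightarrow> Suc t < 2 ^ w" "d * d < 2 ^ w" "k < d \<Longrightarrow> Suc (d * d + k) < 2 ^ w"
  "j \<le> d \<Longrightarrow> j < 2 ^ w"
  using m d n by auto

text \<open>A telescoping sum: each row has a single update of coordinate \<open>k\<close>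
  (\<open>block\<close>), by the previous entry minus the present one, starting from 0.\<close>

lemma added_entry_updates:
  assumes "k < d" "j < d"
  shows "int (added k (map (\<lambda>t. snd (entry_update t)) [0..<Suc j * d])) mod 2 ^ w = (- A j k) mod 2 ^ w"
  using assms(2)
proof (induction j)
  have first: "snd (entry_update t) ! 0 = t mod d" for t
    by (simp add: entry_update_def)
  have block: "added k (map (\<lambda>t. snd (entry_update t)) [j * d..<Suc j * d]) =
      snd (entry_update (j * d + k)) ! 1" for j
  proof -
    have "added k (map (\<lambda>t. snd (entry_update t)) [j * d..<Suc j * d]) =
        (\<Sum>t = j * d..<Suc j * d. if t mod d = k then snd (entry_update t) ! 1 else 0)"
      using first by (simp add: added_def comp_def interv_sum_list_conv_sum_set_nat)
    also have "\<dots> = (\<Sum>t = j * d..<Suc j * d. if t = j * d + k then snd (entry_update t) ! 1 else 0)"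
    proof (rule sum.cong, rule refl)
      fix t assume t: "t \<in> {j * d..<Suc j * d}"
      then obtain i where i: "t = j * d + i" "i < d"
        by (metis add.commute atLeastLessThan_iff le_Suc_ex mult_Suc nat_add_left_cancel_less)
      then show "(if t mod d = k then snd (entry_update t) ! 1 else 0) =
          (if t = j * d + k then snd (entry_update t) ! 1 else 0)"
        by simp
    qed
    also have "\<dots> = snd (entry_update (j * d + k)) ! 1"
      using assms(1) by simp
    finally show ?thesis .
  qed
  have cell: "int (cell (j * d + k)) = A j k mod 2 ^ w" if "j < d" for j
  proof -
    have "j * d + k < Suc j * d"
      using assms(1) by simp
    also have "\<dots> \<le> d * d"
      using that by (simp add: mult_le_mono1 del: mult_Suc)
    finally show ?thesis
      using assms(1) by (simp add: cell_def)
  qed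
  {
    case 0
    then show ?case
      using block[of 0] cell[of 0] assms(1) by (simp add: entry_update_def mod_simps)
  next
    case (Suc j)
    have "[0..<Suc (Suc j) * d] = [0..<Suc j * d] @ [Suc j * d..<Suc (Suc j) * d]"
      by (metis add.commute le_add1 mult_Suc upt_add_eq_append zero_le)
    then have "int (added k (map (\<lambda>t. snd (entry_update t)) [0..<Suc (Suc j) * d])) mod 2 ^ w =
        (int (added k (map (\<lambda>t. snd (entry_update t)) [0..<Suc j * d])) mod 2 ^ w +
          int (snd (entry_update (Suc j * d + k)) ! 1)) mod 2 ^ w"
      using block[of "Suc j"] by (simp add: mod_simps)
    also have "int (snd (entry_update (Suc j * d + k)) ! 1) =
        (int (cell (j * d + k)) - int (cell (Suc j * d + k))) mod 2 ^ w"
      using assms(1) by (simp add: entry_update_def)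
    also have "int (added k (map (\<lambda>t. snd (entry_update t)) [0..<Suc j * d])) mod 2 ^ w = (- A j k) mod 2 ^ w"
      using Suc by simp
    also have "((- A j k) mod 2 ^ w + (int (cell (j * d + k)) - int (cell (Suc j * d + k))) mod 2 ^ w) mod 2 ^ w =
        (- A (Suc j) k) mod 2 ^ w"
      unfolding cell[OF Suc.prems] cell[OF Suc_lessD[OF Suc.prems]] by (simp add: mod_simps)
    finally show ?case .
  }
qed

text \<open>Coordinate updates have names above \<open>d * d\<close>, so the search passes over the
  whole vector before it stops inside \<open>rows\<close>.\<close>

lemma prefix_until_row:
  assumes "j < d"
  shows "prefix_until (Suc j * d) (map (coordinate_update v) [0..<d] @ rows) =
    map (coordinate_update v) [0..<d] @ map entry_update [0..<Suc j * d]"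
proof -
  have le: "0 < Suc j * d" "Suc j * d \<le> d * d"
    using assms d by (simp_all add: mult_le_mono1 del: mult_Suc)
  define t where "t = Suc j * d - 1"
  have t: "Suc j * d = Suc t" "t < d * d"
    using le by (auto simp: t_def)
  have "rows = map entry_update [0..<t] @ entry_update t # map entry_update [Suc t..<d * d]"
    using t(2) by (simp add: rows_def flip: map_append upt_conv_Cons list.map(2))
      (metis le_add_diff_inverse less_imp_le_nat upt_add_eq_append upt_conv_Cons zero_le)
  moreover have "Suc t \<notin> fst ` set (map entry_update [0..<t])"
    by (auto simp: entry_update_def)
  ultimately have "prefix_until (Suc t) rows = map entry_update [0..<Suc t]"
    by (simp add: prefix_until_notin) (simp add: entry_update_def)
  moreover have "Suc t \<notin> fst ` set (map (coordinate_update v) [0..<d])"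
    using t(2) by (auto simp: coordinate_update_def)
  ultimately show ?thesis
    unfolding t(1) by (subst prefix_until_notin) simp_all
qed

lemma added_coordinate_updates:
  "added k (map (\<lambda>i. snd (coordinate_update v i)) [0..<d]) =
     (if k < d then word_op w Sub half (encode w (v k)) else 0)"
  by (simp add: added_def comp_def coordinate_update_def interv_sum_list_conv_sum_set_nat)

lemma added_entry_updates_outside:
  assumes "d \<le> k"
  shows "added k (map (\<lambda>t. snd (entry_update t)) ts) = 0"
proof -
  have "t mod d \<noteq> k" for t
    using assms d by (metis less_le_trans mod_less_divisor not_less zero_less_one)
  then show ?thesis
    by (induction ts) (auto simp: entry_update_def)
qed

text \<open>The first \<open>d\<close> cells hold \<open>half - x k\<close> and the others 0, the
  least word; so the maximum is attained where \<open>x\<close> is least.\<close>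

lemma row_answer:
  assumes v: "\<forall>k<d. entry w (v k)" and j: "j < d"
  shows "int (answer max_problem w []
      (state_at max_problem w n (map (coordinate_update v) [0..<d] @ rows) (Suc j * d))) =
    int half - minplus_mult d A v j" (is "int ?y = _")
proof -
  define a where "a k = added k (map snd (map (coordinate_update v) [0..<d] @
    map entry_update [0..<Suc j * d])) mod 2 ^ w" for k
  have y: "?y = Max (insert 0 (a ` {..<n}))"
    unfolding a_def max_problem_simps Max_state_at prefix_until_row[OF j] ..
  define x where "x k = A j k + v k" for k
  have a: "int (a k) = int half - x k" if "k < d" for k
  proof -
    have "int (a k) = (int (word_op w Sub half (encode w (v k))) +
        int (added k (map (\<lambda>t. snd (entry_update t)) [0..<Suc j * d])) mod 2 ^ w) mod 2 ^ w"
      using that by (simp add: a_def comp_def added_coordinate_updates zmod_int mod_simps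
          del: word_op.simps upt_Suc mult_Suc)
    also have "\<dots> = (int half - x k) mod 2 ^ w"
      unfolding added_entry_updates[OF that j] int_word_sub int_encode mod_add_eq x_def
      by (metis (no_types, opaque_lifting) add_uminus_conv_diff diff_diff_add add.commute
          mod_add_left_eq mod_diff_right_eq)
    \<comment> \<open>The spare bit of the entries: nothing wraps around, so comparing words
      compares the integers.\<close>
    also have "\<dots> = int half - x k"
    proof (rule mod_pos_pos_trivial)
      have "entry w (A j k)" "entry w (v k)"
        using A v j that by auto
      then show "0 \<le> int half - x k" "int half - x k < 2 ^ w"
        using two_half by (auto simp: entry_def x_def)
    qed
    finally show ?thesis .
  qed
  have outside: "a k = 0" if "d \<le> k" for k
    using that by (simp add: a_def comp_def added_coordinate_updates added_entry_updates_outside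
        del: upt_Suc mult_Suc)
  define \<mu> where "\<mu> = minplus_mult d A v j"
  have \<mu>: "\<mu> = Min (x ` {..<d})"
    by (simp add: \<mu>_def minplus_mult_def x_def[abs_def])
  have "\<mu> \<in> x ` {..<d}"
    unfolding \<mu> using d by (intro Min_in) (auto simp: lessThan_empty_iff bot_nat_def)
  then obtain k where k: "k < d" "\<mu> = x k"
    by auto
  have "Max (insert 0 (a ` {..<n})) = a k"
  proof (rule Max_eqI)
    fix b assume "b \<in> insert 0 (a ` {..<n})"
    then consider "b = 0" | i where "i < d" "b = a i"
      using outside by (metis imageE insertE not_le)
    then show "b \<le> a k"
    proof cases
      case (2 i)
      have "\<mu> \<le> x i"
        unfolding \<mu> using 2 by simp
      then show ?thesis
        using a[OF 2(1)] a[OF k(1)] k(2) 2(2) by simp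
    qed simp
  qed (use k d in auto)
  then show ?thesis
    using y a[OF k(1)] k(2) by (simp add: \<mu>_def)
qed

lemma word_sub_row_answer:
  assumes "\<forall>k<d. entry w (v k)" "j < d"
  shows "word_op w Sub half (answer max_problem w []
      (state_at max_problem w n (map (coordinate_update v) [0..<d] @ rows) (Suc j * d))) =
    encode w (minplus_mult d A v j)"
proof -
  have "int (word_op w Sub half (answer max_problem w []
      (state_at max_problem w n (map (coordinate_update v) [0..<d] @ rows) (Suc j * d)))) =
    int (encode w (minplus_mult d A v j))"
    unfolding int_word_sub row_answer[OF assms] by simp
  then show ?thesis
    by (simp only: of_nat_eq_iff)
qed

section \<open>One round of each loop\<close>

lemma runs_insert_entry:
  assumes "running D n w (map entry_update [Suc i..<d * d]) (entry_op i # xs)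
    (\<lambda>S. reg S 0 = d \<and> reg S 5 = 1 \<and> mem S 0 = cell \<and> reg S 2 = Suc i \<and> Suc i \<le> d * d) s0 \<phi>"
  shows "runs w (insert_entry D) s0 (\<lambda>t s'. \<exists>\<phi>'. running D n w (map entry_update [i..<d * d]) xs
    (\<lambda>S. reg S 0 = d \<and> reg S 5 = 1 \<and> mem S 0 = cell \<and> reg S 2 = i \<and> i \<le> d * d) s' \<phi>' \<and> t + \<phi>' \<le> 8 + \<phi>)"
proof -
  from assms obtain s S ts where st: "s0 = overlay 16 3 s S"
    and S: "reg S 0 = d" "reg S 5 = Suc 0" "mem S 0 = cell" "reg S 2 = Suc i" "i < d * d"
    and ops: "operates max_problem n w D (map entry_update [Suc i..<d * d]) s (entry_op i # xs) ts"
    and \<phi>: "\<phi> = sum_list ts"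
    unfolding running_def One_nat_def Suc_le_eq by blast
  have facts: "word_op w Sub (Suc i) (Suc 0) = i" "word_op w Add i (Suc 0) = Suc i"
    "word_op w Mod i d = i mod d" "0 mod 2 ^ w = (0::nat)"
    using word_sub[of 1 "Suc i" w] word_bounds(1)[OF S(5)] by simp_all
  have op: "entry_op i =
      Insert 0 (Suc i) [i mod d, word_op w Sub (if i < d then 0 else cell (i - d)) (cell i)]"
    by (simp add: entry_op_def entry_update_def)
  have prev: "cell (word_op w Sub i d) = (if i < d then 0 else cell (i - d))"
  proof (cases "i < d")
    case True
    have "int (word_op w Sub i d) = 2 ^ w + int i - int d"
    proof -
      have "(int i - int d) mod 2 ^ w = (2 ^ w + int i - int d) mod 2 ^ w"
        by (metis add_diff_eq mod_add_self1)
      also have "\<dots> = 2 ^ w + int i - int d"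
      proof (rule mod_pos_pos_trivial)
        have "int d < 2 ^ w"
          using word_bounds(4)[of d] by simp
        with True show "0 \<le> 2 ^ w + int i - int d" "2 ^ w + int i - int d < 2 ^ w"
          by linarith+
      qed
      finally show ?thesis
        by (simp add: int_word_sub del: word_op.simps)
    qed
    \<comment> \<open>The wrapped address \<open>2 ^ w + i - d\<close> is at least
      \<open>2 ^ w - d\<close>, hence beyond the matrix.\<close>
    moreover have "int (d * d) + int d < 2 ^ w"
      unfolding of_nat_add[symmetric] of_nat_less_numeral_power_cancel_iff using m by linarith
    ultimately have "int (word_op w Sub i d) \<ge> int (d * d)"
      by linarith
    then have "word_op w Sub i d \<ge> d * d"
      by (simp only: of_nat_le_iff)
    then show ?thesis
      using True by (simp add: cell_def del: word_op.simps)
  next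
    case False
    then show ?thesis
      using word_sub[of d i w] word_bounds(1)[OF S(5)] by (simp del: word_op.simps)
  qed
  show ?thesis
    unfolding st insert_entry_def
    apply (simp add: S facts prev del: word_op.simps upt_Suc One_nat_def split del: if_split)
    apply (rule runs_relocate_insert[OF ops[unfolded op]])
    subgoal for t s' ts'
      unfolding edit_entry_op[OF S(5), unfolded op] using S(1-4) less_imp_le[OF S(5)] \<phi>
      by (intro exI[of _ "sum_list ts'"] conjI runningI) simp_all
    done
qed

definition frame :: "(nat \<Rightarrow> int) \<Rightarrow> nat \<Rightarrow> ram \<Rightarrow> bool" where
  "frame v i S \<longleftrightarrow> reg S 0 = d \<and> reg S 5 = 1 \<and> reg S 6 = d * d \<and> reg S 7 = half \<and>
     (\<forall>k<d. mem S 1 k = encode w (v k)) \<and> reg S 2 = i \<and> i \<le> d"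

lemma frame_simps:
  assumes "frame v (Suc i) S"
  shows "reg S 0 = d" "reg S 5 = Suc 0" "reg S 6 = d * d" "reg S 7 = half" "reg S 2 = Suc i"
    "mem S 1 i = encode w (v i)"
    "i < d" "word_op w Sub (Suc i) (Suc 0) = i" "word_op w Mul (Suc i) d = Suc i * d"
    "word_op w Add (d * d) i = d * d + i" "word_op w Add (d * d + i) (Suc 0) = Suc (d * d + i)"
    "word_op w Or i i = i" "(0 :: nat) mod 2 ^ w = 0"
proof -
  show i: "i < d"
    using assms by (simp add: frame_def)
  then have "Suc i * d \<le> d * d"
    by (simp add: mult_le_mono1 del: mult_Suc)
  then have "Suc i * d < 2 ^ w"
    using word_bounds(2) by simp
  then show "word_op w Mul (Suc i) d = Suc i * d"
    by simp
  show "word_op w Sub (Suc i) (Suc 0) = i"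
    using word_sub[of 1 "Suc i" w] word_bounds(4)[of "Suc i"] i by simp
qed (use assms word_bounds(3)[of i] in \<open>auto simp: frame_def or.idem\<close>)

lemma runs_insert_coordinate:
  assumes "running D n w (map (coordinate_update v) [Suc i..<d] @ rows) (coordinate_op v i # xs)
    (frame v (Suc i)) s0 \<phi>"
  shows "runs w (insert_coordinate D) s0 (\<lambda>t s'. \<exists>\<phi>'.
    running D n w (map (coordinate_update v) [i..<d] @ rows) xs (frame v i) s' \<phi>' \<and> t + \<phi>' \<le> 7 + \<phi>)"
proof -
  from assms obtain s S ts where st: "s0 = overlay 16 3 s S"
    and S: "frame v (Suc i) S"
    and ops: "operates max_problem n w D (map (coordinate_update v) [Suc i..<d] @ rows) s
      (coordinate_op v i # xs) ts"
    and \<phi>: "\<phi> = sum_list ts"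
    unfolding running_def by blast
  note facts = frame_simps[OF S]
  have op: "coordinate_op v i = Insert 0 (Suc (d * d + i)) [i, word_op w Sub half (encode w (v i))]"
    by (simp add: coordinate_op_def coordinate_update_def)
  show ?thesis
    unfolding st insert_coordinate_def
    apply (simp add: facts del: word_op.simps One_nat_def)
    apply (rule runs_relocate_insert[OF ops[unfolded op]])
    subgoal for t s' ts'
      unfolding edit_coordinate_op[OF facts(7), of v, unfolded op] using S \<phi> facts(7)
      by (intro exI[of _ "sum_list ts'"] conjI runningI) (auto simp: frame_def)
    done
qed

text \<open>The loop fills bank 2 from the last row downwards.\<close>

definition answered :: "(nat \<Rightarrow> int) \<Rightarrow> nat \<Rightarrow> ram \<Rightarrow> bool" where
  "answered v i S \<longleftrightarrow> (\<forall>j. i \<le> j \<longrightarrow> j < d \<longrightarrow> mem S 2 j = encode w (minplus_mult d A v j))"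

lemma runs_query_row:
  assumes v: "\<forall>k<d. entry w (v k)"
    and "running D n w (map (coordinate_update v) [0..<d] @ rows) (row_query i # xs)
      (\<lambda>S. frame v (Suc i) S \<and> answered v (Suc i) S) s0 \<phi>"
  shows "runs w (query_row D) s0 (\<lambda>t s'. \<exists>\<phi>'.
    running D n w (map (coordinate_update v) [0..<d] @ rows) xs (\<lambda>S. frame v i S \<and> answered v i S) s' \<phi>' \<and>
    t + \<phi>' \<le> 4 + \<phi>)"
proof -
  from assms(2) obtain s S ts where st: "s0 = overlay 16 3 s S"
    and S: "frame v (Suc i) S" "answered v (Suc i) S"
    and ops: "operates max_problem n w D (map (coordinate_update v) [0..<d] @ rows) s (row_query i # xs) ts"
    and \<phi>: "\<phi> = sum_list ts"
    unfolding running_def by blast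
  note facts = frame_simps[OF S(1)]
  have ans: "mem S 2 j = encode w (minplus_mult d A v j)" if "i < j" "j < d" for j
    using S(2) that by (simp add: answered_def Suc_le_eq)
  show ?thesis
    unfolding st query_row_def
    apply (simp add: facts del: word_op.simps One_nat_def mult_Suc)
    apply (rule runs_relocate_query[OF ops[unfolded row_query_def]])
    subgoal for t s' ts'
      using S(1) ans \<phi> facts word_sub_row_answer[OF v facts(7)]
      apply (simp del: word_op.simps One_nat_def mult_Suc max_problem_simps)
      apply (intro exI[of _ "sum_list ts'"] conjI runningI)
       apply (auto simp: answered_def frame_def simp del: word_op.simps mult_Suc max_problem_simps)
      done
    done
qed

lemma runs_delete_coordinate:
  assumes "running D n w (map (coordinate_update v) [0..<Suc i] @ rows) (coordinate_deletion i # xs)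
      (\<lambda>S. frame v (Suc i) S \<and> answered v 0 S) s0 \<phi>"
  shows "runs w (delete_coordinate D) s0 (\<lambda>t s'. \<exists>\<phi>'.
    running D n w (map (coordinate_update v) [0..<i] @ rows) xs (\<lambda>S. frame v i S \<and> answered v 0 S) s' \<phi>' \<and>
    t + \<phi>' \<le> 3 + \<phi>)"
proof -
  from assms obtain s S ts where st: "s0 = overlay 16 3 s S"
    and S: "frame v (Suc i) S" "answered v 0 S"
    and ops: "operates max_problem n w D (map (coordinate_update v) [0..<Suc i] @ rows) s
      (coordinate_deletion i # xs) ts"
    and \<phi>: "\<phi> = sum_list ts"
    unfolding running_def by blast
  note facts = frame_simps[OF S(1)]
  show ?thesis
    unfolding st delete_coordinate_def
    apply (simp add: facts del: word_op.simps One_nat_def)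
    apply (rule runs_relocate_delete[OF ops[unfolded coordinate_deletion_def]])
    subgoal for t s' ts'
      unfolding edit_coordinate_deletion[OF facts(7), unfolded coordinate_deletion_def]
      using S \<phi> facts(7)
      by (intro exI[of _ "sum_list ts'"] conjI runningI) (auto simp: answered_def frame_def)
    done
qed

section \<open>Whole loops, whole vectors, the whole computation\<close>

lemma runs_insert_coordinates:
  assumes "running D n w rows (map (coordinate_op v) (rev [0..<d]) @ xs) (frame v d) s0 \<phi>"
  shows "runs w (While 2 (insert_coordinate D)) s0 (\<lambda>t s'. \<exists>\<phi>'.
    running D n w (map (coordinate_update v) [0..<d] @ rows) xs (frame v 0) s' \<phi>' \<and> t + \<phi>' \<le> (7 + 1) * d + 1 + \<phi>)"
  by (rule running_countdown[where L = "\<lambda>i. map (coordinate_update v) [i..<d] @ rows"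
        and op = "coordinate_op v" and F = "frame v"], erule runs_insert_coordinate)
    (use assms in \<open>simp_all add: frame_def\<close>)

lemma runs_query_rows:
  assumes "\<forall>k<d. entry w (v k)"
    and "running D n w (map (coordinate_update v) [0..<d] @ rows) (map row_query (rev [0..<d]) @ xs)
      (\<lambda>S. frame v d S \<and> answered v d S) s0 \<phi>"
  shows "runs w (While 2 (query_row D)) s0 (\<lambda>t s'. \<exists>\<phi>'.
    running D n w (map (coordinate_update v) [0..<d] @ rows) xs (\<lambda>S. frame v 0 S \<and> answered v 0 S) s' \<phi>' \<and>
    t + \<phi>' \<le> (4 + 1) * d + 1 + \<phi>)"
  by (rule running_countdown[where L = "\<lambda>_. map (coordinate_update v) [0..<d] @ rows"
        and op = row_query and F = "\<lambda>i S. frame v i S \<and> answered v i S"],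
      erule runs_query_row[OF assms(1)]) (use assms(2) in \<open>simp_all add: frame_def\<close>)

lemma runs_delete_coordinates:
  assumes "running D n w (map (coordinate_update v) [0..<d] @ rows) (map coordinate_deletion (rev [0..<d]) @ xs)
      (\<lambda>S. frame v d S \<and> answered v 0 S) s0 \<phi>"
  shows "runs w (While 2 (delete_coordinate D)) s0 (\<lambda>t s'. \<exists>\<phi>'.
    running D n w rows xs (\<lambda>S. frame v 0 S \<and> answered v 0 S) s' \<phi>' \<and> t + \<phi>' \<le> (3 + 1) * d + 1 + \<phi>)"
proof -
  have "runs w (While 2 (delete_coordinate D)) s0 (\<lambda>t s'. \<exists>\<phi>'.
      running D n w (map (coordinate_update v) [0..<0] @ rows) xs (\<lambda>S. frame v 0 S \<and> answered v 0 S) s' \<phi>' \<and>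
      t + \<phi>' \<le> (3 + 1) * d + 1 + \<phi>)"
    by (rule running_countdown[where L = "\<lambda>i. map (coordinate_update v) [0..<i] @ rows"
          and op = coordinate_deletion and F = "\<lambda>i S. frame v i S \<and> answered v 0 S"],
        erule runs_delete_coordinate) (use assms in \<open>simp_all add: frame_def\<close>)
  then show ?thesis
    by simp
qed

lemma runs_insert_entries:
  assumes "running D n w [] (matrix_ops @ xs)
    (\<lambda>S. reg S 0 = d \<and> reg S 5 = 1 \<and> mem S 0 = cell \<and> reg S 2 = d * d) s0 \<phi>"
  shows "runs w (While 2 (insert_entry D)) s0 (\<lambda>t s'. \<exists>\<phi>'.
    running D n w rows xs (\<lambda>S. reg S 0 = d \<and> reg S 5 = 1) s' \<phi>' \<and> t + \<phi>' \<le> (8 + 1) * (d * d) + 1 + \<phi>)"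
proof -
  let ?F = "\<lambda>i S. reg S 0 = d \<and> reg S 5 = 1 \<and> mem S 0 = cell \<and> reg S 2 = i \<and> i \<le> d * d"
  have "runs w (While 2 (insert_entry D)) s0 (\<lambda>t s'. \<exists>\<phi>'.
      running D n w (map entry_update [0..<d * d]) xs (?F 0) s' \<phi>' \<and> t + \<phi>' \<le> (8 + 1) * (d * d) + 1 + \<phi>)"
    by (rule running_countdown[where L = "\<lambda>i. map entry_update [i..<d * d]"
          and op = entry_op and F = ?F], erule runs_insert_entry)
      (use assms in \<open>simp_all add: matrix_ops_def\<close>)
  then show ?thesis
    unfolding rows_def[symmetric]
    by (rule runs_mono) (elim exE conjE, rule exI, rule conjI, erule running_mono, simp_all)
qed

text \<open>The loops cost 8, 5 and 4 steps per round besides the calls, which makes 17; three final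
  tests and seven other instructions make 10.\<close>

lemma runs_step:
  assumes v: "\<forall>k<d. entry w (v k)"
    and run: "running D n w rows (vector_ops v @ xs) (\<lambda>S. reg S 0 = d \<and> reg S 5 = 1) s0 \<phi>"
  shows "runs w (step_code D) (load_vector w d v s0) (\<lambda>t s'. \<exists>\<phi>'.
    running D n w rows xs (\<lambda>S. reg S 0 = d \<and> reg S 5 = 1 \<and> answered v 0 S) s' \<phi>' \<and>
    t + \<phi>' \<le> 17 * d + 10 + \<phi>)"
proof -
  let ?s = "load_vector w d v s0"
  have reg: "reg ?s 0 = d" "reg ?s 5 = 1"
    using running_reg[OF run, of 0 d] running_reg[OF run, of 5 1] by (simp_all add: load_vector_def)
  have words: "word_op w Mul d d = d * d" "word_op w Or d d = d" "(0::nat) mod 2 ^ w = 0"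
    "word_op w Shr (word_op w Sub 0 1) 1 = half"
  proof -
    have "word_op w Sub 0 1 = 2 ^ w - 1"
    proof -
      have "int (word_op w Sub 0 1) = int (2 ^ w - 1)"
        by (simp add: zmod_minus1 of_nat_diff)
      then show ?thesis
        by (simp only: of_nat_eq_iff)
    qed
    then show "word_op w Shr (word_op w Sub 0 1) 1 = half"
      by (simp add: half_def del: word_op.simps(2))
  qed (use word_bounds in simp_all)
  let ?s1 = "set_reg 2 d (set_reg 7 half (set_reg 6 (d * d) ?s))"
  have "running D n w rows (vector_ops v @ xs)
      (\<lambda>S. reg S 0 = d \<and> reg S 5 = 1 \<and> (\<forall>k<d. mem S 1 k = encode w (v k))) ?s \<phi>"
    using run by (rule running_load_vector) (simp add: load_vector_def)
  then have "running D n w rows (vector_ops v @ xs) (frame v d) ?s1 \<phi>"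
    by (rule running_set_reg[OF running_set_reg[OF running_set_reg]])
      (auto simp: frame_def)
  have insert: "runs w (While 2 (insert_coordinate D)) ?s1 (\<lambda>t s'. \<exists>\<phi>'.
      running D n w (map (coordinate_update v) [0..<d] @ rows)
        (map row_query (rev [0..<d]) @ map coordinate_deletion (rev [0..<d]) @ xs) (frame v 0) s' \<phi>' \<and>
      t + \<phi>' \<le> (7 + 1) * d + 1 + \<phi>)"
    by (rule runs_insert_coordinates) (use \<open>running D n w rows (vector_ops v @ xs) (frame v d) ?s1 \<phi>\<close> in \<open>simp add: vector_ops_def\<close>)
  have query: "runs w (While 2 (query_row D)) (set_reg 2 d s) (\<lambda>t s'. \<exists>\<phi>'.
      running D n w (map (coordinate_update v) [0..<d] @ rows) (map coordinate_deletion (rev [0..<d]) @ xs)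
        (\<lambda>S. frame v 0 S \<and> answered v 0 S) s' \<phi>' \<and> t + \<phi>' \<le> (4 + 1) * d + 1 + \<phi>)"
    if "running D n w (map (coordinate_update v) [0..<d] @ rows)
      (map row_query (rev [0..<d]) @ map coordinate_deletion (rev [0..<d]) @ xs) (frame v 0) s \<phi>" for s \<phi>
    by (rule runs_query_rows[OF v], rule running_set_reg[OF that]) (auto simp: frame_def answered_def)
  have delete: "runs w (While 2 (delete_coordinate D)) (set_reg 2 d s) (\<lambda>t s'. \<exists>\<phi>'.
      running D n w rows xs (\<lambda>S. frame v 0 S \<and> answered v 0 S) s' \<phi>' \<and> t + \<phi>' \<le> (3 + 1) * d + 1 + \<phi>)"
    if "running D n w (map (coordinate_update v) [0..<d] @ rows) (map coordinate_deletion (rev [0..<d]) @ xs)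
        (\<lambda>S. frame v 0 S \<and> answered v 0 S) s \<phi>" for s \<phi>
    by (rule runs_delete_coordinates, rule running_set_reg[OF that]) (auto simp: frame_def answered_def)
  have reg0: "reg s 0 = d" if "running D n w L ys F s \<phi>" "\<And>S. F S \<Longrightarrow> frame v 0 S" for L ys F s \<phi>
    using that by (elim running_reg) (auto simp: frame_def)
  show ?thesis
    unfolding step_code_def
    apply (simp add: reg words del: word_op.simps One_nat_def)
    apply (rule runs_mono[OF insert])
    apply (elim exE conjE)
    apply (simp add: reg0 words del: word_op.simps One_nat_def)
    apply (rule runs_mono[OF query], assumption)
    apply (elim exE conjE)
    apply (simp add: reg0[where F = "\<lambda>S. frame v 0 S \<and> answered v 0 S"] words del: word_op.simps One_nat_def)
    apply (rule runs_mono[OF delete], assumption)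
    apply (elim exE conjE)
    apply (rule exI, rule conjI, erule running_mono)
     apply (simp_all add: frame_def)
    done
qed

text \<open>The code sees the current vector only; the operations for later vectors occur just as
  work that the structure has ahead of it.\<close>

lemma online_products_step:
  assumes "\<forall>v\<in>set vs. \<forall>k<d. entry w (v k)"
    and "running D n w rows (concat (map vector_ops vs)) (\<lambda>S. reg S 0 = d \<and> reg S 5 = 1) s0 \<phi>"
  shows "\<exists>t. online_products w d A (step_code D) s0 vs t \<and> t \<le> (17 * d + 10) * length vs + \<phi>"
  using assms
proof (induction vs arbitrary: s0 \<phi>)
  case (Cons v vs)
  from Cons.prems have "runs w (step_code D) (load_vector w d v s0) (\<lambda>t s'. \<exists>\<phi>'.
    running D n w rows (concat (map vector_ops vs))
      (\<lambda>S. reg S 0 = d \<and> reg S 5 = 1 \<and> answered v 0 S) s' \<phi>' \<and> t + \<phi>' \<le> 17 * d + 10 + \<phi>)"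
    by (intro runs_step) auto
  then obtain t1 s1 \<phi>1 where s1: "exec w (step_code D) (load_vector w d v s0) t1 s1"
    "running D n w rows (concat (map vector_ops vs))
      (\<lambda>S. reg S 0 = d \<and> reg S 5 = 1 \<and> answered v 0 S) s1 \<phi>1" "t1 + \<phi>1 \<le> 17 * d + 10 + \<phi>"
    unfolding runs_def by blast
  from Cons.IH[OF _ running_mono[OF s1(2)]] Cons.prems(1) obtain t2 where
    t2: "online_products w d A (step_code D) s1 vs t2" "t2 \<le> (17 * d + 10) * length vs + \<phi>1"
    by auto
  have "mem s1 2 j = encode w (minplus_mult d A v j)" if "j < d" for j
    using s1(2) by (rule running_mem) (use that in \<open>auto simp: answered_def\<close>)
  with s1 t2 show ?case
    by (intro exI[of _ "t1 + t2"]) auto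
qed simp

lemma reduction_run:
  assumes size: "n = K * d + r"
    and init: "exec w (init_code D) (pass [n] blank) t0 s0"
    and ops: "operates max_problem n w D [] s0 (matrix_ops @ concat (map vector_ops vs)) ts"
    and vs: "length vs = d" "\<forall>v\<in>set vs. \<forall>k<d. entry w (v k)"
  shows "\<exists>u s1 t. exec w (prep_code D K r) (pass [d] (load_matrix w d A)) u s1 \<and>
    online_products w d A (step_code D) s1 vs t \<and> u + t \<le> t0 + sum_list ts + 50 * d\<^sup>2"
proof -
  define S where "S = set_reg 2 r (set_reg 1 (K * d) (pass [d] (load_matrix w d A)))"
  have "K \<le> K * d"
    using d by simp
  then have "K < 2 ^ w" "r < 2 ^ w" "K * d < 2 ^ w"
    using size n by linarith+
  then have words: "K mod 2 ^ w = K" "r mod 2 ^ w = r" "word_op w Mul K d = K * d"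
      "word_op w Add (K * d) r = n" "(1::nat) mod 2 ^ w = 1" "word_op w Mul d d = d * d"
    using n size word_length_pos word_bounds(2) by auto
  \<comment> \<open>Registers from 16 and banks from 3 are still zero, so the host's state already
    contains a blank guest.\<close>
  have blank: "overlay 16 3 blank S' = S'" if "\<And>i. i \<ge> 16 \<Longrightarrow> reg S' i = 0" "\<And>b. b \<ge> 3 \<Longrightarrow> mem S' b = (\<lambda>_. 0)"
    for S'
    using that by (auto simp: overlay_def blank_def fun_eq_iff intro!: ram.equality)
  have "set_reg 16 n S = overlay 16 3 (pass [n] blank) S"
  proof -
    have "overlay 16 3 blank S = S"
      by (rule blank) (auto simp: S_def load_matrix_def blank_def)
    moreover have "set_reg 16 n (overlay 16 3 blank S) = overlay 16 3 (pass [n] blank) S"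
      by (simp add: pass_1)
    ultimately show ?thesis by simp
  qed
  with exec_relocate[OF init] have init': "exec w (relocate 16 3 (init_code D)) (set_reg 16 n S) t0 (overlay 16 3 s0 S)"
    by simp
  let ?S = "set_reg 2 (d * d) (set_reg 5 1 S)"
  have "running D n w [] (matrix_ops @ concat (map vector_ops vs))
      (\<lambda>S. reg S 0 = d \<and> reg S 5 = 1 \<and> mem S 0 = cell \<and> reg S 2 = d * d) (overlay 16 3 s0 ?S) (sum_list ts)"
    using ops by (intro runningI) (auto simp: S_def load_matrix_def cell_def fun_eq_iff)
  note insert = runs_insert_entries[OF this]
  have "runs w (prep_code D K r) (pass [d] (load_matrix w d A)) (\<lambda>u s1. \<exists>\<phi>.
    running D n w rows (concat (map vector_ops vs)) (\<lambda>S. reg S 0 = d \<and> reg S 5 = 1) s1 \<phi> \<and>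
    u + \<phi> \<le> 9 * (d * d) + 7 + t0 + sum_list ts)"
  proof -
    have "runs w (Const 5 1 ;; Op 2 Mul 0 0 ;; While 2 (insert_entry D)) (overlay 16 3 s0 S)
      (\<lambda>u s1. \<exists>\<phi>. running D n w rows (concat (map vector_ops vs)) (\<lambda>S. reg S 0 = d \<and> reg S 5 = 1) s1 \<phi> \<and>
         u + \<phi> \<le> 9 * (d * d) + 3 + sum_list ts)"
      unfolding runs_Seq runs_Const runs_Op
      using insert words by (auto simp: S_def simp del: word_op.simps One_nat_def elim!: runs_mono)
    then have "runs w (relocate 16 3 (init_code D) ;; Const 5 1 ;; Op 2 Mul 0 0 ;; While 2 (insert_entry D))
      (set_reg 16 n S)
      (\<lambda>u s1. \<exists>\<phi>. running D n w rows (concat (map vector_ops vs)) (\<lambda>S. reg S 0 = d \<and> reg S 5 = 1) s1 \<phi> \<and>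
         u + \<phi> \<le> 9 * (d * d) + 3 + t0 + sum_list ts)"
      using init' by (subst runs_Seq) (auto simp: runs_def[of w "relocate 16 3 (init_code D)"] elim!: runs_mono intro!: exI)
    then show ?thesis
      unfolding prep_code_def runs_Seq[of w "Const 1 K"] runs_Seq[of w "Op 1 Mul 1 0"] runs_Seq[of w "Const 2 r"]
        runs_Seq[of w "Op 16 Add 1 2"] runs_Const runs_Op
      using words by (auto simp: S_def simp del: word_op.simps One_nat_def runs_Seq elim!: runs_mono)
  qed
  then obtain u s1 \<phi> where u: "exec w (prep_code D K r) (pass [d] (load_matrix w d A)) u s1"
    "running D n w rows (concat (map vector_ops vs)) (\<lambda>S. reg S 0 = d \<and> reg S 5 = 1) s1 \<phi>"
    "u + \<phi> \<le> 9 * (d * d) + 7 + t0 + sum_list ts"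
    unfolding runs_def by blast
  from online_products_step[OF vs(2) u(2)] vs(1) obtain t where
    t: "online_products w d A (step_code D) s1 vs t" "t \<le> (17 * d + 10) * d + \<phi>"
    by auto
  have "1 \<le> d * d" "d \<le> d * d"
    using d by (auto simp: Suc_le_eq)
  moreover have "(17 * d + 10) * d = 17 * (d * d) + 10 * d"
    by (simp add: algebra_simps)
  \<comment> \<open>The host takes at most 26 * d * d + 10 * d + 7 steps of its own, which is below
    50 * d * d.\<close>
  ultimately have "u + t \<le> t0 + sum_list ts + 50 * d\<^sup>2"
    unfolding power2_eq_square using u(3) t(2) by linarith
  with u(1) t(1) show ?thesis by blast
qed

end

text \<open>The first summand is the amortized bound for the set-up and the \<open>4 * d ^ 2\<close>
  operations, the second the host's own work.\<close>

lemma solves_online_minplus_if_retroactive_ds: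
  assumes ds: "retroactive_ds Full max_problem n m w D (amortized n T)"
    and size: "n = K * d + r" "1 \<le> d" "d \<le> n" "n < 2 ^ w" "d * d + d \<le> m" "m < 2 ^ w"
  shows "solves_online_minplus w d (prep_code D K r) (step_code D)
    ((real n + 1 + 4 * real d ^ 2) * T + 50 * real d ^ 2)"
  unfolding solves_online_minplus_def
proof (intro allI impI)
  fix A vs
  assume A: "\<forall>j<d. \<forall>k<d. entry w (A j k)" and vs: "length vs = d" "\<forall>v\<in>set vs. \<forall>k<d. entry w (v k)"
  interpret reduction w n d m D A
    by standard (use size A in auto)
  let ?xs = "matrix_ops @ concat (map vector_ops vs)"
  from ds legal_all_ops[of vs] obtain t0 s0 ts where init: "exec w (init_code D) (pass [n] blank) t0 s0"
    and ops: "operates max_problem n w D [] s0 ?xs ts" and time: "amortized n T t0 ts"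
    unfolding retroactive_ds_def by blast
  have "length ts = 4 * d\<^sup>2"
    using operates_length[OF ops] length_all_ops[of vs] vs(1) by (simp add: power2_eq_square)
  with time have "real (t0 + sum_list ts) \<le> (real n + 1 + 4 * real d ^ 2) * T"
    by (simp add: amortized_def)
  moreover from reduction_run[OF size(1) init ops vs] obtain u s1 t where
    "exec w (prep_code D K r) (pass [d] (load_matrix w d A)) u s1"
    "online_products w d A (step_code D) s1 vs t" "u + t \<le> t0 + sum_list ts + 50 * d\<^sup>2"
    by blast
  moreover from this(3) have "real (u + t) \<le> real (t0 + sum_list ts) + 50 * real d ^ 2"
    using of_nat_mono[where 'a = real] by fastforce
  ultimately show "\<exists>t0 s0 t. exec w (prep_code D K r) (pass [d] (load_matrix w d A)) t0 s0 \<and>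
      online_products w d A (step_code D) s0 vs t \<and>
      real (t0 + t) \<le> (real n + 1 + 4 * real d ^ 2) * T + 50 * real d ^ 2"
    by force
qed

subsection \<open>Asymptotics\<close>

lemma eventually_le_powr:
  assumes "0 < (p :: real)"
  shows "\<forall>\<^sub>F n in sequentially. b \<le> real n powr p"
  using eventually_ge_at_top[of "nat \<lceil>max b 1 powr (1 / p)\<rceil>"]
proof eventually_elim
  case (elim n)
  have "b \<le> (max b 1 powr (1 / p)) powr p"
    using assms by (simp add: powr_powr)
  also have "\<dots> \<le> real n powr p"
  proof (rule powr_mono2)
    show "max b 1 powr (1 / p) \<le> real n"
      using elim by linarith
  qed (use assms in auto)
  finally show ?case .
qed

text \<open>Replaces the hidden function \<open>f\<close> by a statement for each
  \<open>\<epsilon>\<close>, which can be combined over finitely many residues.\<close>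

lemma almost_power_lower_bound_iff:
  "almost_power_lower_bound a T \<longleftrightarrow>
     (\<forall>\<epsilon>>0. \<forall>\<^sub>F n in sequentially. real n powr (a - \<epsilon>) \<le> \<bar>T n\<bar>)"
proof (intro iffI allI impI)
  fix \<epsilon> :: real assume "almost_power_lower_bound a T" and \<epsilon>: "\<epsilon> > 0"
  then obtain f where f: "f \<in> o(\<lambda>_. 1 :: real)" and T: "T \<in> \<Omega>(\<lambda>n. real n powr (a - f n))"
    unfolding almost_power_lower_bound_def by blast
  from T obtain c where c: "c > 0"
    "\<forall>\<^sub>F n in sequentially. c * norm (real n powr (a - f n)) \<le> norm (T n)"
    by (elim landau_omega.bigE) 
  have f': "\<forall>\<^sub>F n in sequentially. \<bar>f n\<bar> \<le> \<epsilon> / 2"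
    using landau_o.smallD[OF f, of "\<epsilon> / 2"] \<epsilon> by simp
  have large: "\<forall>\<^sub>F n in sequentially. 1 / c \<le> real n powr (\<epsilon> / 2)"
    using \<epsilon> by (intro eventually_le_powr) simp
  show "\<forall>\<^sub>F n in sequentially. real n powr (a - \<epsilon>) \<le> \<bar>T n\<bar>"
    using c(2) f' large eventually_gt_at_top[of 0]
  proof eventually_elim
    case (elim n)
    have "real n powr (a - \<epsilon>) = 1 * real n powr (a - \<epsilon>)"
      by simp
    \<comment> \<open>One half of \<open>\<epsilon>\<close> absorbs the constant \<open>c\<close>,
      the other half \<open>f n\<close>.\<close>
    also have "\<dots> \<le> (c * real n powr (\<epsilon> / 2)) * real n powr (a - \<epsilon>)"
      using elim(3) c(1) by (intro mult_right_mono) (simp_all add: field_simps)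
    also have "\<dots> = c * real n powr (a - \<epsilon> / 2)"
      by (simp add: mult.assoc flip: powr_add)
    also have "\<dots> \<le> c * real n powr (a - f n)"
      using elim c(1) by (intro mult_left_mono powr_mono) auto
    also have "\<dots> \<le> \<bar>T n\<bar>"
      using elim(1) by simp
    finally show ?case .
  qed
next
  assume T: "\<forall>\<epsilon>>0. \<forall>\<^sub>F n in sequentially. real n powr (a - \<epsilon>) \<le> \<bar>T n\<bar>"
  \<comment> \<open>The amount by which the exponent of \<open>T n\<close> falls short of
    \<open>a\<close>. The value 0 where \<open>T n = 0\<close> is a placeholder: this happens for
    finitely many \<open>n\<close> only.\<close>
  define f where "f n = (if T n = 0 then 0 else max 0 (a - log (real n) \<bar>T n\<bar>))" for n
  have "\<forall>\<^sub>F n in sequentially. \<bar>f n\<bar> \<le> \<epsilon> * \<bar>1\<bar>" if "\<epsilon> > 0" for \<epsilon>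
    using T[rule_format, OF that] eventually_gt_at_top[of 1]
  proof eventually_elim
    case (elim n)
    show ?case
    proof (cases "T n = 0")
      case False
      have "a - \<epsilon> \<le> log (real n) \<bar>T n\<bar>"
        using elim False by (subst le_log_iff) auto
      then show ?thesis
        using that False by (simp add: f_def)
    qed (use that in \<open>simp add: f_def\<close>)
  qed
  then have "f \<in> o(\<lambda>_. 1)"
    by (intro landau_o.smallI) simp
  moreover have "T \<in> \<Omega>(\<lambda>n. real n powr (a - f n))"
  proof (rule landau_omega.bigI[of 1])
    show "\<forall>\<^sub>F n in sequentially. 1 * norm (real n powr (a - f n)) \<le> norm (T n)"
      using T[rule_format, OF zero_less_one] eventually_gt_at_top[of 1]
    proof eventually_elim
      case (elim n)
      then have "0 < real n powr (a - 1)"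
        by simp
      with elim(1) have "T n \<noteq> 0"
        by auto
      then have "real n powr (a - f n) \<le> real n powr (log (real n) \<bar>T n\<bar>)"
        using elim(2) by (intro powr_mono) (simp_all add: f_def)
      also have "\<dots> = \<bar>T n\<bar>"
        using elim(2) \<open>T n \<noteq> 0\<close> by simp
      finally show ?case by simp
    qed
  qed simp
  ultimately show "almost_power_lower_bound a T"
    unfolding almost_power_lower_bound_def by blast
qed

section \<open>From sizes \<open>K * d + r\<close> to all sizes\<close>

lemma less_two_power_if_word_length:
  assumes "1 \<le> c" "c * log 2 (real N + 1) \<le> real w"
  shows "N < 2 ^ w"
proof -
  have "1 * log 2 (real N + 1) \<le> c * log 2 (real N + 1)"
    using assms(1) by (intro mult_right_mono) simp_all
  then have "log 2 (real N + 1) \<le> real w"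
    using assms(2) by simp
  then have "real N + 1 \<le> 2 powr real w"
    by (subst (asm) log_le_iff) simp_all
  then have "real N < 2 ^ w"
    unfolding powr_realpow[OF zero_less_numeral] by linarith
  then have "real N < real (2 ^ w)"
    by simp
  then show ?thesis
    by (simp only: of_nat_less_iff)
qed

text \<open>The conjecture wants words of length about log (d * d), with the same \<open>c\<close>.
  The lower bound holds as \<open>M\<close> is at least \<open>d ^ 2\<close>; for the upper one,
  size and \<open>M\<close> are O(d * d), and a constant factor under the logarithm becomes a
  summand.\<close>

lemma word_length_linear:
  assumes c: "0 \<le> c" and K: "1 \<le> K"
    and W: "word_length c (\<lambda>n. max n (M n)) W"
    and lower: "\<And>d. 1 \<le> d \<Longrightarrow> d\<^sup>2 \<le> M (K * d + r)"
    and upper: "(\<lambda>n. real (M n)) \<in> O(\<lambda>n. real n ^ 2)"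
  shows "word_length c (\<lambda>d. d\<^sup>2) (\<lambda>d. W (K * d + r))"
  unfolding word_length_def
proof (intro conjI allI)
  fix d
  show "c * log 2 (real (d\<^sup>2) + 1) \<le> real (W (K * d + r))"
  proof (cases "d = 0")
    case False
    have "c * log 2 (real (d\<^sup>2) + 1) \<le> c * log 2 (real (max (K * d + r) (M (K * d + r))) + 1)"
    proof (intro mult_left_mono c log_mono)
      have "d\<^sup>2 \<le> max (K * d + r) (M (K * d + r))"
        using lower[of d] False by auto
      then show "real (d\<^sup>2) + 1 \<le> real (max (K * d + r) (M (K * d + r))) + 1"
        by (simp only: of_nat_le_iff add_le_cancel_right)
    qed (simp_all add: add_nonneg_pos del: of_nat_power)
    also have "\<dots> \<le> real (W (K * d + r))"
      using W by (simp add: word_length_def)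
    finally show ?thesis .
  qed simp
next
  let ?n = "\<lambda>d. K * d + r"
  have lim: "filterlim ?n sequentially sequentially"
  proof (rule filterlim_at_top_mono[OF filterlim_ident])
    show "\<forall>\<^sub>F d in sequentially. d \<le> K * d + r"
      using K by (intro always_eventually allI) (simp add: trans_le_add1)
  qed
  have "(\<lambda>d. real (W (?n d))) \<in> O(\<lambda>d. log 2 (real (max (?n d) (M (?n d))) + 1))"
    using W landau_o.big.compose[OF _ lim] unfolding word_length_def by blast
  also have "(\<lambda>d. log 2 (real (max (?n d) (M (?n d))) + 1)) \<in> O(\<lambda>d. log 2 (real (d\<^sup>2) + 1))"
  proof -
    from upper obtain a where a: "a > 0"
      "\<forall>\<^sub>F n in sequentially. norm (real (M n)) \<le> a * norm (real n ^ 2)"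
      by (elim landau_o.bigE)
    from a(2) lim have M: "\<forall>\<^sub>F d in sequentially. norm (real (M (?n d))) \<le> a * norm (real (?n d) ^ 2)"
      by (rule eventually_compose_filterlim)
    \<comment> \<open>Chosen so that the maximum plus 1 is at most \<open>b * (d ^ 2 + 1)\<close>.
      As the logarithm of \<open>d ^ 2 + 1\<close> is at least 1, the summand \<open>log 2 b\<close>
      becomes a factor.\<close>
    define b where "b = (1 + a) * real (K + r) ^ 2 + 1"
    have b: "b \<ge> 1"
      using a(1) by (simp add: b_def)
    show ?thesis
    proof (rule landau_o.bigI[of "log 2 b + 1"])
      show "0 < log 2 b + 1"
        using b by (simp add: add_nonneg_pos)
      show "\<forall>\<^sub>F d in sequentially. norm (log 2 (real (max (?n d) (M (?n d))) + 1)) \<le>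
          (log 2 b + 1) * norm (log 2 (real (d\<^sup>2) + 1))"
        using M eventually_ge_at_top[of 1]
      proof eventually_elim
        case (elim d)
        define q where "q = real (K + r) * real d"
        have "r * 1 \<le> r * d"
          using elim(2) by (intro mult_left_mono) auto
        then have "?n d \<le> (K + r) * d"
          by (simp add: add_mult_distrib)
        then have n: "real (?n d) \<le> q"
          unfolding q_def of_nat_mult[symmetric] by (simp only: of_nat_le_iff)
        have "1 * 1 \<le> (K + r) * d"
          using K elim(2) by (intro mult_mono) auto
        then have q: "1 \<le> q"
          unfolding q_def of_nat_mult[symmetric] by (metis One_nat_def mult_1 of_nat_1 of_nat_le_iff)
        have "real (M (?n d)) \<le> a * real (?n d) ^ 2"
          using elim(1) by simp
        also have "\<dots> \<le> a * q ^ 2"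
          using n a(1) by (intro mult_left_mono power_mono) auto
        finally have "real (M (?n d)) \<le> a * q ^ 2" .
        moreover have "real (?n d) \<le> 1 * q ^ 2"
          using n q self_le_power[OF q, of 2] by simp
        moreover have "0 \<le> q ^ 2" "0 \<le> a * q ^ 2"
          using a(1) by auto
        ultimately have "real (max (?n d) (M (?n d))) \<le> (1 + a) * q ^ 2"
          unfolding distrib_right of_nat_max by (intro max.boundedI) linarith+
        moreover have "(1 + a) * q ^ 2 = (b - 1) * real (d\<^sup>2)"
          by (simp add: q_def b_def power_mult_distrib)
        moreover have "b * (real (d\<^sup>2) + 1) = (b - 1) * real (d\<^sup>2) + real (d\<^sup>2) + b"
          by (simp add: algebra_simps)
        ultimately have "real (max (?n d) (M (?n d))) + 1 \<le> b * (real (d\<^sup>2) + 1)"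
          using b of_nat_0_le_iff[of "d\<^sup>2", where 'a = real] by linarith
        then have "log 2 (real (max (?n d) (M (?n d))) + 1) \<le> log 2 (b * (real (d\<^sup>2) + 1))"
          by (intro log_mono) (simp_all add: add_nonneg_pos)
        also have "\<dots> = log 2 b + log 2 (real (d\<^sup>2) + 1)"
          using b by (subst log_mult_pos) (auto simp: add_nonneg_pos)
        also have "\<dots> \<le> log 2 b * log 2 (real (d\<^sup>2) + 1) + log 2 (real (d\<^sup>2) + 1)"
        proof -
          have "2 \<le> real (d\<^sup>2) + 1"
            using elim(2) by simp
          then have "1 \<le> log 2 (real (d\<^sup>2) + 1)"
            by (subst le_log_iff) auto
          then show ?thesis
            using b by (simp add: mult_le_cancel_left1)
        qed
        finally have "log 2 (real (max (?n d) (M (?n d))) + 1) \<le>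
            log 2 b * log 2 (real (d\<^sup>2) + 1) + log 2 (real (d\<^sup>2) + 1)" .
        moreover have "0 \<le> log 2 (real k + 1)" for k
          by simp
        ultimately show ?case
          by (simp only: real_norm_def abs_of_nonneg distrib_right mult_1)
      qed
    qed
  qed
  finally show "(\<lambda>d. real (W (?n d))) \<in> O(\<lambda>d. log 2 (real (d\<^sup>2) + 1))" .
qed

text \<open>Dividing the total by \<open>d ^ 2\<close> leaves an exponent of 1 -
  \<open>\<epsilon>\<close> / 2; the surplus of \<open>\<epsilon>\<close> / 2 over the claim
  swallows all constants.\<close>

lemma lower_bound_per_operation:
  assumes T: "\<And>n. n \<ge> 1 \<Longrightarrow> 0 \<le> T n" and K: "1 \<le> K" and \<epsilon>: "0 < \<epsilon>" "\<epsilon> < 1"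
    and total: "almost_power_lower_bound 3
      (\<lambda>d. (real (K * d + r) + 1 + 4 * real d ^ 2) * T (K * d + r) + 50 * real d ^ 2)"
  shows "\<forall>\<^sub>F d in sequentially. real (K * d + r) powr (1 - \<epsilon>) \<le> T (K * d + r)"
proof -
  define B where "B = real (K + r) + 5"
  have B: "B \<ge> 1" by (simp add: B_def)
  \<comment> \<open>One factor \<open>B\<close> accounts for the number of operations, the other for
    passing from \<open>d\<close> to \<open>n\<close>, and 50 for the host.\<close>
  have large: "\<forall>\<^sub>F n in sequentially. B\<^sup>2 + 50 \<le> real n powr (\<epsilon> / 2)"
    using \<epsilon> by (intro eventually_le_powr) simp
  have "\<forall>\<^sub>F d in sequentially. real d powr (3 - \<epsilon> / 2) \<le>
      \<bar>(real (K * d + r) + 1 + 4 * real d ^ 2) * T (K * d + r) + 50 * real d ^ 2\<bar>"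
    using total \<epsilon> unfolding almost_power_lower_bound_iff by simp
  then show ?thesis
    using large eventually_ge_at_top[of 1]
  proof eventually_elim
    case (elim d)
    define n where "n = K * d + r"
    define x where "x = real d powr (1 - \<epsilon>)"
    have d: "1 \<le> real d" "real d \<le> real d ^ 2" "1 \<le> real d ^ 2"
      using elim(3) self_le_power[of "real d" 2] by simp_all
    have "1 * 1 \<le> K * d"
      using K elim(3) by (intro mult_mono) auto
    then have n: "n \<ge> 1"
      unfolding n_def by linarith
    have "real n = real K * real d + real r * 1"
      by (simp add: n_def)
    also have "\<dots> \<le> real K * real d + real r * real d"
      using d by (intro add_left_mono mult_left_mono) auto
    finally have n_le: "real n \<le> real (K + r) * real d"
      by (simp add: algebra_simps)
    have x: "x \<ge> 1"
      using d \<epsilon> by (simp add: x_def ge_one_powr_ge_zero)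
    have "real n powr (1 - \<epsilon>) \<le> (B * real d) powr (1 - \<epsilon>)"
      using n_le \<epsilon> d by (intro powr_mono2) (auto simp: B_def algebra_simps)
    also have "\<dots> = B powr (1 - \<epsilon>) * x"
      using B by (simp add: x_def powr_mult)
    also have "\<dots> \<le> B powr 1 * x"
      using B \<epsilon> x by (intro mult_right_mono powr_mono) auto
    finally have n_powr: "real n powr (1 - \<epsilon>) \<le> B * x"
      using B by simp
    have "real (K + r) * real d \<le> real (K + r) * real d ^ 2"
      using d by (intro mult_left_mono) auto
    then have ops: "real n + 1 + 4 * real d ^ 2 \<le> B * real d ^ 2"
      unfolding B_def distrib_right using n_le d by linarith
    have "(B\<^sup>2 + 50) * x * real d ^ 2 \<le> real d powr (\<epsilon> / 2) * x * real d ^ 2"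
      using elim(2) x by (intro mult_right_mono) auto
    also have "\<dots> = real d powr (3 - \<epsilon> / 2)"
      using elim(3) by (simp add: x_def flip: powr_add powr_numeral)
    also have "\<dots> \<le> \<bar>(real n + 1 + 4 * real d ^ 2) * T n + 50 * real d ^ 2\<bar>"
      using elim(1) by (simp add: n_def)
    also have "\<dots> = (real n + 1 + 4 * real d ^ 2) * T n + 50 * real d ^ 2"
      using T[OF n] by simp
    also have "\<dots> \<le> B * real d ^ 2 * T n + 50 * real d ^ 2"
      using mult_right_mono[OF ops T[OF n]] by simp
    finally have "((B\<^sup>2 + 50) * x) * real d ^ 2 \<le> (B * T n + 50) * real d ^ 2"
      by (simp add: algebra_simps)
    then have "(B\<^sup>2 + 50) * x \<le> B * T n + 50"
      using d by (simp add: mult_le_cancel_right)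
    moreover have "50 \<le> 50 * x"
      using x by simp
    ultimately have "B * (B * x) \<le> B * T n"
      by (simp add: algebra_simps power2_eq_square)
    then have "B * x \<le> T n"
      using B by (simp add: mult_le_cancel_left)
    with n_powr show ?case
      by (simp add: n_def)
  qed
qed

lemma eventually_sequentially_residues:
  assumes K: "(1 :: nat) \<le> K" and P: "\<And>r. r < K \<Longrightarrow> \<forall>\<^sub>F d in sequentially. P (K * d + r)"
  shows "\<forall>\<^sub>F n in sequentially. P n"
proof -
  have "\<forall>\<^sub>F d in sequentially. \<forall>r\<in>{..<K}. P (K * d + r)"
    using P by (intro eventually_ball_finite) auto
  moreover have "filterlim (\<lambda>n. n div K) sequentially sequentially"
    unfolding filterlim_at_top eventually_sequentially
  proof (intro allI exI impI)
    fix Z n assume "K * Z \<le> n"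
    then show "Z \<le> n div K"
      using K by (simp add: less_eq_div_iff_mult_less_eq mult.commute)
  qed
  ultimately have "\<forall>\<^sub>F n in sequentially. \<forall>r\<in>{..<K}. P (K * (n div K) + r)"
    by (rule eventually_compose_filterlim)
  then show ?thesis
  proof eventually_elim
    case (elim n)
    then have "P (K * (n div K) + n mod K)"
      by (rule bspec) (use K in simp)
    then show ?case by simp
  qed
qed

text \<open>For each \<open>r\<close> the conjecture is applied to the programs with the constants
  \<open>K\<close> and \<open>r\<close>; the finitely many resulting bounds together cover almost
  all \<open>n\<close>.\<close>

lemma fully_retroactive_lower_bound:
  assumes c: "c \<ge> 1" and conjecture: "online_minplus_conjecture c"
    and M: "(\<lambda>n. real (M n)) \<in> \<Theta>(\<lambda>n. real n ^ 2)"
    and W: "word_length c (\<lambda>n. max n (M n)) W"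
    and ds: "\<And>n. n \<ge> 1 \<Longrightarrow> retroactive_ds Full max_problem n (M n) (W n) D (amortized n (T n))"
  shows "almost_power_lower_bound 1 T"
proof -
  \<comment> \<open>The empty sequence of operations already forces this, through the set-up
    time.\<close>
  have T: "0 \<le> T n" if "n \<ge> 1" for n
  proof -
    from ds[OF that] obtain t0 s0 where "\<forall>xs. legal_ops Full max_problem (M n) (W n) [] xs \<longrightarrow>
        (\<exists>ts. operates max_problem n (W n) D [] s0 xs ts \<and> amortized n (T n) t0 ts)"
      unfolding retroactive_ds_def by blast
    from this[rule_format, of "[]"] have "amortized n (T n) t0 []"
      by simp
    then have "0 \<le> (real n + 1) * T n"
      by (simp add: amortized_def)
    then show ?thesis
      by (simp add: zero_le_mult_iff)
  qed
  from M have "(\<lambda>n. real (M n)) \<in> \<Omega>(\<lambda>n. real n ^ 2)" "(\<lambda>n. real (M n)) \<in> O(\<lambda>n. real n ^ 2)"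
    by auto
  then obtain a where a0: "a > 0" "\<forall>\<^sub>F n in sequentially. a * norm (real n ^ 2) \<le> norm (real (M n))"
    by (elim landau_omega.bigE)
  then obtain N0 where a: "a > 0" "\<And>n. n \<ge> N0 \<Longrightarrow> a * real n ^ 2 \<le> real (M n)"
    by (auto simp: eventually_sequentially)
  \<comment> \<open>\<open>N0\<close> puts all sizes into the range where \<open>a * n ^ 2\<close>
    bounds \<open>M n\<close> from below; 2 / a makes this at least \<open>2 * d ^ 2\<close>, hence
    at least \<open>d * d + d\<close>.\<close>
  define K where "K = max 1 (max N0 (nat \<lceil>2 / a\<rceil>))"
  have K: "1 \<le> K" "N0 \<le> K" "2 / a \<le> real K"
    unfolding K_def by linarith+
  have room: "d * d + d \<le> M (K * d + r)" if d: "1 \<le> d" for d r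
  proof -
    let ?n = "K * d + r"
    have "K * 1 \<le> K * d"
      using d by (intro mult_left_mono) auto
    then have n: "?n \<ge> N0"
      using K(2) by linarith
    have "2 \<le> a * real K"
      using K(3) a(1) by (simp add: field_simps)
    also have "\<dots> \<le> a * real K ^ 2"
      using a(1) K(1) self_le_power[of "real K" 2] by (intro mult_left_mono) auto
    finally have "2 * real d ^ 2 \<le> a * real K ^ 2 * real d ^ 2"
      by (intro mult_right_mono) auto
    also have "\<dots> = a * real (K * d) ^ 2"
      by (simp add: power_mult_distrib)
    also have "\<dots> \<le> a * real ?n ^ 2"
      using a(1) by (intro mult_left_mono power_mono) auto
    also have "\<dots> \<le> real (M ?n)"
      by (rule a(2)[OF n])
    finally have "real (2 * d\<^sup>2) \<le> real (M ?n)"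
      by simp
    then have "2 * d\<^sup>2 \<le> M ?n"
      by (simp only: of_nat_le_iff)
    moreover have "d \<le> d * d"
      using d by simp
    ultimately show ?thesis
      unfolding power2_eq_square by linarith
  qed
  have total: "almost_power_lower_bound 3
      (\<lambda>d. (real (K * d + r) + 1 + 4 * real d ^ 2) * T (K * d + r) + 50 * real d ^ 2)" for r
  proof -
    have "d\<^sup>2 \<le> M (K * d + r)" if "1 \<le> d" for d
      using room[OF that, of r] by (simp add: power2_eq_square)
    then have "word_length c (\<lambda>d. d\<^sup>2) (\<lambda>d. W (K * d + r))"
      using c K W \<open>(\<lambda>n. real (M n)) \<in> O(\<lambda>n. real n ^ 2)\<close> by (intro word_length_linear) auto
    moreover have "solves_online_minplus (W (K * d + r)) d (prep_code D K r) (step_code D)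
        ((real (K * d + r) + 1 + 4 * real d ^ 2) * T (K * d + r) + 50 * real d ^ 2)" if d: "1 \<le> d" for d
    proof -
      have "1 * d \<le> K * d"
        using K by (intro mult_right_mono) auto
      then have n: "d \<le> K * d + r" "1 \<le> K * d + r"
        using d by linarith+
      have "max (K * d + r) (M (K * d + r)) < 2 ^ W (K * d + r)"
        using W by (intro less_two_power_if_word_length[OF c]) (simp add: word_length_def)
      then show ?thesis
        using d n room[OF d] by (intro solves_online_minplus_if_retroactive_ds[OF ds]) auto
    qed
    ultimately show ?thesis
      by (rule conjecture[unfolded online_minplus_conjecture_def, rule_format])
  qed
  show ?thesis
    unfolding almost_power_lower_bound_iff
  proof (intro allI impI)
    fix \<epsilon> :: real assume "\<epsilon> > 0"
    \<comment> \<open>Keeps the exponent of \<open>n\<close> positive, as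
      \<open>lower_bound_per_operation\<close> requires; a larger \<open>\<epsilon>\<close> only
      weakens the claim.\<close>
    define \<delta> where "\<delta> = min \<epsilon> (1 / 2)"
    have \<delta>: "0 < \<delta>" "\<delta> < 1" "\<delta> \<le> \<epsilon>"
      using \<open>\<epsilon> > 0\<close> by (auto simp: \<delta>_def)
    have "\<forall>\<^sub>F n in sequentially. real n powr (1 - \<delta>) \<le> T n"
      by (rule eventually_sequentially_residues[OF K(1)])
        (rule lower_bound_per_operation[OF T K(1) \<delta>(1,2) total])
    then show "\<forall>\<^sub>F n in sequentially. real n powr (1 - \<epsilon>) \<le> \<bar>T n\<bar>"
      using eventually_ge_at_top[of 1]
    proof eventually_elim
      case (elim n)
      have "real n powr (1 - \<epsilon>) \<le> real n powr (1 - \<delta>)"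
        using elim(2) \<delta>(3) by (intro powr_mono) auto
      with elim(1) show ?case by linarith
    qed
  qed
qed

theorem theorem2:
  fixes c :: real
  assumes "c \<ge> 1"
    and "online_minplus_conjecture c"
  shows "\<exists>P. data_structure_problem P \<and>
    (\<exists>D C. \<forall>n\<ge>2. \<forall>m w. c * log 2 (real (max n m) + 1) \<le> real w \<longrightarrow>
       retroactive_ds Partial P n m w D (worst_case n (C * log 2 (real n)))) \<and>
    (\<forall>M W D T. (\<lambda>n. real (M n)) \<in> \<Theta>(\<lambda>n. real n ^ 2) \<longrightarrow>
       word_length c (\<lambda>n. max n (M n)) W \<longrightarrow>
       (\<forall>n\<ge>1. retroactive_ds Full P n (M n) (W n) D (amortized n (T n))) \<longrightarrow>
       almost_power_lower_bound 1 T)"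
proof (intro exI[of _ max_problem] conjI allI impI)
  show "data_structure_problem max_problem"
    by (rule data_structure_problem_max_problem)
  show "\<exists>D C. \<forall>n\<ge>2. \<forall>m w. c * log 2 (real (max n m) + 1) \<le> real w \<longrightarrow>
      retroactive_ds Partial max_problem n m w D (worst_case n (C * log 2 (real n)))"
  proof (intro exI[of _ max_tree] exI[of _ 52] allI impI)
    fix n m w :: nat
    assume "2 \<le> n" "c * log 2 (real (max n m) + 1) \<le> real w"
    then show "retroactive_ds Partial max_problem n m w max_tree (worst_case n (52 * log 2 (real n)))"
      using less_two_power_if_word_length[OF assms(1)] by (intro max_tree_retroactive) fastforce+
  qed
next
  fix M W D T
  assume "(\<lambda>n. real (M n)) \<in> \<Theta>(\<lambda>n. real n ^ 2)" "word_length c (\<lambda>n. max n (M n)) W"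
    "\<forall>n\<ge>1. retroactive_ds Full max_problem n (M n) (W n) D (amortized n (T n))"
  then show "almost_power_lower_bound 1 T"
    using fully_retroactive_lower_bound[OF assms] by blast
qed

end
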